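(* Let $d \geqslant 2$ and let $\Gamma < \mathrm{Isom}(\mathbb{H}^d)$ be a finitely generated, Zariski dense, discrete group containing at least one reflection in a hyperplane. Then $\Gamma$ contains a discrete Zariski dense subgroup generated by finitely many reflections. Moreover, if the maximal reflection subgroup of $\Gamma$ has infinite index in $\Gamma$, then $\Gamma$ contains a sequence of subgroups $W_1 < W_2 < W_3 < \cdots$, each $W_n$ being a Zariski dense finitely generated hyperbolic reflection group, such that $W_n$ has infinite index in $W_{n+1}$ for all $n$.
   Context: $\mathbb{H}^d$ is the real hyperbolic space of dimension $d$, realized as one sheet $\{v : (v,v)=-1\}$ of the hyperboloid in the Minkowski space $\mathbb{R}^{d,1}$. Its full isometry group $\mathrm{Isom}(\mathbb{H}^d)$ is an index $2$ subgroup of $\mathrm{O}_{d,1}(\mathbb{R})$ and is identified with the group of real points of the real algebraic group $\mathbf{PO}_{d,1}$; "Zariski dense" means Zariski dense in $\mathrm{Isom}(\mathbb{H}^d)$ with respect to this algebraic structure. A reflection is the reflection in a hyperplane (a codimension-one totally geodesic subspace) of $\mathbb{H}^d$. A (hyperbolic) reflection group is a discrete subgroup of $\mathrm{Isom}(\mathbb{H}^d)$ generated by reflections in hyperplanes. The maximal reflection subgroup of $\Gamma$ is the subgroup generated by all reflections contained in $\Gamma$. *)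

theory Defs
  imports "HOL-Analysis.Analysis" "HOL-Algebra.Generated_Groups"
begin

section \<open>The hyperboloid model and its isometry group\<close>

text \<open>
  The dimension \<open>d\<close> is \<open>CARD('n)\<close>. Coordinates of Minkowski space are indexed by \<open>'n option\<close>:
  \<open>Some i\<close> for the \<open>d\<close> spacelike coordinates, \<open>None\<close> for the timelike one.
\<close>

type_synonym 'n minkowski = "(real, 'n option) vec"
type_synonym 'n mink_matrix = "((real, 'n option) vec, 'n option) vec"

definition mink :: "('n::finite) minkowski \<Rightarrow> 'n minkowski \<Rightarrow> real" where
  "mink x y = (\<Sum>i\<in>UNIV. x $ Some i * y $ Some i) - x $ None * y $ None"

definition hyperboloid :: "('n::finite) minkowski set" where
  "hyperboloid = {x. mink x x = -1 \<and> x $ None > 0}"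

definition lorentz :: "('n::finite) mink_matrix set" where
  "lorentz = {A. \<forall>x y. mink (A *v x) (A *v y) = mink x y}"

text \<open>
  The full isometry group of hyperbolic space, as the index 2 subgroup of \<open>O(d,1)\<close>
  preserving the chosen sheet of the hyperboloid.
\<close>

definition Isom :: "('n::finite) mink_matrix monoid" where
  "Isom = \<lparr>carrier = {A \<in> lorentz. (\<lambda>x. A *v x) ` hyperboloid = hyperboloid},
           mult = (**), one = mat 1\<rparr>"

section \<open>Reflections\<close>

text \<open>
  The hyperplanes of hyperbolic space are the sets of points of the hyperboloid orthogonal to
  a spacelike vector \<open>e\<close>.
\<close>

definition hyperplane :: "('n::finite) minkowski \<Rightarrow> 'n minkowski set" where
  "hyperplane e = {x \<in> hyperboloid. mink x e = 0}"

definition is_reflection :: "('n::finite) mink_matrix \<Rightarrow> bool" where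
  "is_reflection A \<longleftrightarrow>
     (\<exists>e. mink e e > 0 \<and> (\<forall>x. A *v x = x - (2 * mink x e / mink e e) *\<^sub>R e))"

section \<open>Zariski density\<close>

text \<open>
  Since \<open>d \<ge> 2\<close>, the real points of \<open>PO(d,1)\<close> are \<open>O(d,1) / {1, -1}\<close>, and \<open>Isom\<close> contains exactly
  one of \<open>A\<close>, \<open>-A\<close> for every \<open>A\<close> in \<open>O(d,1)\<close>. The regular functions on \<open>PO(d,1)\<close> are those on
  \<open>O(d,1)\<close> invariant under \<open>A \<mapsto> -A\<close>, that is, the restrictions of the even polynomials in the matrix
  entries. Using all polynomials instead would give a strictly finer topology on \<open>Isom\<close> when \<open>d\<close>
  is even: the determinant would separate the identity component, which is Zariski dense in
  \<open>PO(d,1)\<close>.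
\<close>

definition PO_regular :: "(('n::finite) mink_matrix \<Rightarrow> real) \<Rightarrow> bool" where
  "PO_regular f \<longleftrightarrow> real_polynomial_function f \<and> (\<forall>A. f (- A) = f A)"

definition zariski_closure :: "('n::finite) mink_matrix set \<Rightarrow> 'n mink_matrix set" where
  "zariski_closure S =
     {A \<in> carrier Isom. \<forall>f. PO_regular f \<and> (\<forall>B\<in>S. f B = 0) \<longrightarrow> f A = 0}"

definition zariski_dense :: "('n::finite) mink_matrix set \<Rightarrow> bool" where
  "zariski_dense S \<longleftrightarrow> S \<subseteq> carrier Isom \<and> zariski_closure S = carrier Isom"

section \<open>Discrete groups and reflection groups\<close>

text \<open>
  The topology of \<open>Isom\<close> is the one induced from the space of matrices, so a subgroup is discrete
  iff it is discrete as a set of matrices.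
\<close>

definition discrete_subgroup :: "('n::finite) mink_matrix set \<Rightarrow> bool" where
  "discrete_subgroup H \<longleftrightarrow> subgroup H Isom \<and> discrete H"

definition finitely_generated :: "('n::finite) mink_matrix set \<Rightarrow> bool" where
  "finitely_generated H \<longleftrightarrow> (\<exists>S. finite S \<and> S \<subseteq> carrier Isom \<and> H = generate Isom S)"

definition reflection_group :: "('n::finite) mink_matrix set \<Rightarrow> bool" where
  "reflection_group W \<longleftrightarrow>
     discrete_subgroup W \<and> (\<exists>S. (\<forall>r\<in>S. is_reflection r) \<and> W = generate Isom S)"

definition max_reflection_subgroup :: "('n::finite) mink_matrix set \<Rightarrow> 'n mink_matrix set" where
  "max_reflection_subgroup \<Gamma> = generate Isom {r \<in> \<Gamma>. is_reflection r}"

text \<open>Intended for subgroups \<open>H \<subseteq> K\<close> of \<open>Isom\<close>.\<close>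

definition infinite_index :: "('n::finite) mink_matrix set \<Rightarrow> 'n mink_matrix set \<Rightarrow> bool" where
  "infinite_index H K \<longleftrightarrow> infinite (rcosets\<^bsub>Isom\<lparr>carrier := K\<rparr>\<^esub> H)"

section \<open>Basic facts\<close>

lemma mink_add: "mink (x + y) z = mink x z + mink y z" "mink z (x + y) = mink z x + mink z y"
  by (simp_all add: mink_def sum.distrib algebra_simps)

lemma mink_diff: "mink (x - y) z = mink x z - mink y z" "mink z (x - y) = mink z x - mink z y"
  by (simp_all add: mink_def sum_subtractf algebra_simps)

lemma mink_scaleR: "mink (c *\<^sub>R x) y = c * mink x y" "mink x (c *\<^sub>R y) = c * mink x y"
  by (simp_all add: mink_def sum_distrib_left algebra_simps)

lemma mink_commute: "mink x y = mink y x"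
  by (simp add: mink_def mult.commute)

lemma mink_nondegenerate:
  fixes x :: "('n::finite) minkowski"
  assumes "\<And>y. mink x y = 0"
  shows "x = 0"
proof -
  have "mink x (\<chi> k. case k of None \<Rightarrow> - (x $ None) | Some i \<Rightarrow> x $ Some i) = 0"
    using assms .
  then have *: "(\<Sum>i\<in>UNIV. (x $ Some i)\<^sup>2) + (x $ None)\<^sup>2 = 0"
    by (simp add: mink_def power2_eq_square)
  have nn: "(\<Sum>i\<in>UNIV. (x $ Some i)\<^sup>2) \<ge> 0"
    by (simp add: sum_nonneg)
  have a: "x $ None = 0"
    using * nn zero_le_power2[of "x $ None"] by (smt (verit) zero_eq_power2)
  then have "(\<Sum>i\<in>UNIV. (x $ Some i)\<^sup>2) = 0"
    using * by simp
  then have "x $ Some i = 0" for i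
    by (simp add: sum_nonneg_eq_0_iff)
  with a show ?thesis
    by (metis (no_types) not_Some_eq vec_eq_iff zero_index)
qed

lemma Isom_simps [simp]:
  "mult Isom = (**)" "one Isom = mat 1"
  by (simp_all add: Isom_def)

lemma carrier_Isom_iff:
  "A \<in> carrier Isom \<longleftrightarrow>
     (\<forall>x y. mink (A *v x) (A *v y) = mink x y) \<and> (\<lambda>x. A *v x) ` hyperboloid = hyperboloid"
  by (simp add: Isom_def lorentz_def)

lemma group_Isom: "group (Isom :: ('n::finite) mink_matrix monoid)"
proof (rule groupI)
  fix A B :: "'n mink_matrix"
  assume A: "A \<in> carrier Isom" and B: "B \<in> carrier Isom"
  have "(\<lambda>x. (A ** B) *v x) ` hyperboloid = (\<lambda>x. A *v x) ` (\<lambda>x. B *v x) ` hyperboloid"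
    by (simp add: image_image matrix_vector_mul_assoc)
  with A B show "A \<otimes>\<^bsub>Isom\<^esub> B \<in> carrier Isom"
    by (simp add: carrier_Isom_iff flip: matrix_vector_mul_assoc)
next
  fix A :: "'n mink_matrix"
  assume A: "A \<in> carrier Isom"
  have "x = y" if "A *v x = A *v y" for x y
  proof -
    have "mink (x - y) z = 0" for z
    proof -
      have "mink (x - y) z = mink (A *v (x - y)) (A *v z)"
        using A by (simp add: carrier_Isom_iff)
      also have "\<dots> = 0"
        using that by (simp add: matrix_vector_mult_diff_distrib mink_def)
      finally show ?thesis .
    qed
    then show ?thesis using mink_nondegenerate[of "x - y"] by simp
  qed
  then obtain B where BA: "B ** A = mat 1"
    using matrix_left_invertible_injective[of A] by (auto simp: inj_def)
  then have AB: "A ** B = mat 1" by (simp add: matrix_left_right_inverse)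
  have Bm: "mink (B *v x) (B *v y) = mink x y" for x y
  proof -
    have "mink (B *v x) (B *v y) = mink (A *v (B *v x)) (A *v (B *v y))"
      using A by (simp add: carrier_Isom_iff)
    then show ?thesis by (simp add: matrix_vector_mul_assoc AB)
  qed
  have "(\<lambda>x. B *v x) ` hyperboloid = (\<lambda>x. B *v x) ` (\<lambda>x. A *v x) ` hyperboloid"
    using A by (simp add: carrier_Isom_iff)
  also have "\<dots> = hyperboloid"
    by (simp add: image_image matrix_vector_mul_assoc BA)
  finally show "\<exists>B\<in>carrier Isom. B \<otimes>\<^bsub>Isom\<^esub> A = \<one>\<^bsub>Isom\<^esub>"
    using BA Bm by (auto simp: carrier_Isom_iff)
qed (auto simp: carrier_Isom_iff matrix_mul_assoc)

lemma reflection_fixes_hyperplane: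
  assumes "mink e e > 0" "\<And>x. A *v x = x - (2 * mink x e / mink e e) *\<^sub>R e"
  shows "{x \<in> hyperboloid. A *v x = x} = hyperplane e"
proof -
  have "e \<noteq> 0" using assms(1) by (auto simp: mink_def)
  then show ?thesis using assms by (auto simp: hyperplane_def)
qed

lemma reflection_in_Isom:
  assumes "is_reflection A"
  shows "A \<in> carrier Isom"
proof -
  obtain e where e: "mink e e > 0" and A: "\<And>x. A *v x = x - (2 * mink x e / mink e e) *\<^sub>R e"
    using assms by (auto simp: is_reflection_def)
  have m: "mink (A *v x) (A *v y) = mink x y" for x y
    using e by (simp add: A mink_diff mink_scaleR mink_commute[of e x] mink_commute[of e y] field_simps)
  have inv: "A *v (A *v x) = x" for x
    using e by (simp add: A mink_diff mink_scaleR flip: scaleR_add_left)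
  have pos: "A *v x \<in> hyperboloid" if x: "x \<in> hyperboloid" for x
  proof -
    let ?y = "A *v x"
    define s where "s v = (\<chi> i. v $ Some i)" for v :: "'a minkowski"
    have mk: "mink u v = inner (s u) (s v) - u $ None * v $ None" for u v
      by (simp add: mink_def s_def inner_vec_def)
    have yy: "mink ?y ?y = -1" and xx: "mink x x = -1" and x0: "x $ None > 0"
      using x m by (auto simp: hyperboloid_def)
    have xy: "mink x ?y \<le> -1"
      using e xx by (simp add: A mink_diff mink_scaleR divide_nonneg_pos)
    have "?y $ None > 0"
    proof (rule ccontr)
      assume n: "\<not> ?y $ None > 0"
      have "(norm (s ?y))\<^sup>2 \<le> (?y $ None)\<^sup>2" "(norm (s x))\<^sup>2 \<le> (x $ None)\<^sup>2"
        using yy xx by (simp_all add: mk power2_norm_eq_inner)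
          (simp_all add: power2_eq_square)
      then have "norm (s ?y) \<le> \<bar>?y $ None\<bar>" "norm (s x) \<le> \<bar>x $ None\<bar>"
        by (simp_all flip: abs_le_square_iff)
      then have "norm (s x) * norm (s ?y) \<le> x $ None * - (?y $ None)"
        using n x0 by (intro mult_mono) auto
      moreover have "- (norm (s x) * norm (s ?y)) \<le> inner (s x) (s ?y)"
        using Cauchy_Schwarz_ineq2[of "s x" "s ?y"] by linarith
      ultimately have "mink x ?y \<ge> 0" by (simp add: mk)
      with xy show False by simp
    qed
    with yy show ?thesis by (simp add: hyperboloid_def)
  qed
  have "(\<lambda>x. A *v x) ` hyperboloid = hyperboloid"
    using pos inv by (auto simp: image_iff) (metis)
  with m show ?thesis by (simp add: carrier_Isom_iff)
qed

end

theory Submission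
  imports Defs
begin

text \<open>
  Mirrors are encoded by roots, the unit normals \<open>e\<close> (two for each mirror) whose reflection
  \<open>refl e\<close> lies in the group.

  \<^bold>\<open>Zariski density.\<close> Let \<open>Z\<close> be the Zariski closure of the group generated by finitely many
  reflections of \<open>\<Gamma>\<close>. The rational map \<open>v \<mapsto> refl v\<close> turns the condition \<open>refl v \<in> Z\<close> into
  polynomial equations in \<open>v\<close>, so it propagates along lines. If two mirrors of \<open>Z\<close> are
  ultraparallel, their dihedral group already contains infinitely many mirrors of the pencil, hence
  \<open>Z\<close> contains the reflections in all spacelike vectors of the plane spanned by the normals
  (\<open>ultraparallel_plane_in_hull\<close>). If \<open>Z\<close> contains all reflections with normal in a Lorentzian
  subspace \<open>U\<close> and one more with normal \<open>c\<close> not orthogonal to \<open>U\<close>, it contains all those with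
  normal in the span of \<open>U\<close> and \<open>c\<close> (\<open>refls_in_hull_insert\<close>). Zariski density of \<open>\<Gamma>\<close> means that
  the \<open>\<Gamma>\<close>-orbit of a root cannot be told from the set of all unit spacelike vectors by even
  polynomials; this yields an ultraparallel pair of roots and, as long as \<open>U\<close> is a proper subspace,
  a suitable \<open>c\<close>. After at most \<open>d + 1\<close> steps \<open>Z\<close> contains all reflections, and these generate the
  isometry group.

  \<^bold>\<open>Chains.\<close> Fix a point \<open>p\<close> off all mirrors; it determines positive roots and simple roots, the
  latter being the walls of the chamber of \<open>p\<close>. Simple roots generate all reflections of \<open>\<Gamma>\<close>
  (\<open>refl_in_simple_group\<close>). If there were only finitely many, then, since they span, the stabilizer
  of the chamber would be finite, and the maximal reflection subgroup would have finite index
  (\<open>finite_index_if_finite_simple\<close>). So in the case of infinite index there are infinitely many. Take a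
  finite set of them whose group contains a Zariski dense group as above, and add further simple roots
  one at a time.

  Each step has infinite index (\<open>infinite_index_insert_simple\<close>). Let \<open>s\<close> be a simple root outside \<open>I\<close>.
  The group \<open>H\<close> of \<open>I\<close> permutes the positive roots whose reflections lie outside \<open>H\<close>, and \<open>s\<close> is
  one of them. With a root \<open>f\<close> ultraparallel to \<open>s\<close>, some power of \<open>T = refl s ** refl f\<close> would lie
  in \<open>H\<close> if the index were finite, and all powers of this power, positive or negative, would send
  \<open>s\<close> to positive roots. But \<open>refl s\<close> inverts \<open>T\<close>, so the product of the heights of \<open>T^n s\<close> and
  \<open>T^(-n) s\<close>, the values of \<open>mink p\<close> there, stays bounded; by discreteness only finitely many
  roots would occur, which is impossible for a translation.
\<close>

section \<open>Minkowski geometry\<close>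

lemma mink_zero [simp]: "mink 0 x = 0" "mink x 0 = 0"
  by (simp_all add: mink_def)

lemma mink_minus: "mink (- x) y = - mink x y" "mink x (- y) = - mink x y"
  by (simp_all add: mink_def sum_negf)

lemmas mink_bilinear = mink_add mink_diff mink_scaleR mink_minus

lemma sum_option:
  fixes f :: "('n::finite) option \<Rightarrow> real"
  shows "(\<Sum>k\<in>UNIV. f k) = f None + (\<Sum>i\<in>UNIV. f (Some i))"
  by (simp add: UNIV_option_conv sum.reindex)

text \<open>
  The involution exchanging the Minkowski form and the Euclidean inner product; it transports
  orthogonality and norm estimates between the two.
\<close>

definition time_flip :: "('n::finite) minkowski \<Rightarrow> 'n minkowski" where
  "time_flip x = (\<chi> k. case k of None \<Rightarrow> - (x $ None) | Some i \<Rightarrow> x $ Some i)"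

lemma mink_inner: "mink x y = inner (time_flip x) y"
  by (simp add: mink_def time_flip_def inner_vec_def sum_option)

lemma time_flip_inner: "inner x y = mink (time_flip x) y"
  by (simp add: mink_def time_flip_def inner_vec_def sum_option)

lemma mink_axis: "mink x (axis k 1) = time_flip x $ k"
  by (simp add: mink_inner inner_axis)

lemma time_flip_eq_0 [simp]: "time_flip x = 0 \<longleftrightarrow> x = 0"
proof
  assume "time_flip x = 0"
  then have "mink x y = 0" for y by (simp add: mink_inner)
  then show "x = 0" by (rule mink_nondegenerate)
qed (simp add: mink_inner vec_eq_iff time_flip_def split: option.splits)

lemma bounded_linear_mink_right: "bounded_linear (\<lambda>x. mink y x)"
  unfolding mink_inner by (rule bounded_linear_inner_right)

lemma real_polynomial_mink:
  assumes "polynomial_function f" "polynomial_function g"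
  shows "real_polynomial_function (\<lambda>x. mink (f x) (g x) :: real)"
proof -
  have fg: "real_polynomial_function (\<lambda>x. f x $ k)" "real_polynomial_function (\<lambda>x. g x $ k)" for k
    using assms bounded_linear_vec_nth[of k] unfolding polynomial_function_def o_def by blast+
  have "real_polynomial_function (\<lambda>x. f x $ k * g x $ k)" for k
    by (rule real_polynomial_function.intros(4)[OF fg])
  then show ?thesis
    unfolding mink_def by (intro real_polynomial_function_diff real_polynomial_function_sum) auto
qed

definition space_part :: "('n::finite) minkowski \<Rightarrow> real ^ 'n" where
  "space_part x = (\<chi> i. x $ Some i)"

lemma mink_space_part: "mink x y = inner (space_part x) (space_part y) - x $ None * y $ None"
  by (simp add: mink_def space_part_def inner_vec_def)

lemma mink_self_space_part: "mink x x = (norm (space_part x))\<^sup>2 - (x $ None)\<^sup>2"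
  by (simp add: mink_space_part dot_square_norm power2_eq_square)

lemma minkowski_zeroI: "space_part x = 0 \<Longrightarrow> x $ None = 0 \<Longrightarrow> x = 0"
  by (simp add: vec_eq_iff space_part_def) (metis option.exhaust)

lemma hyperboloidD:
  assumes "p \<in> hyperboloid"
  shows "mink p p = -1" "p $ None > 0" "norm (space_part p) < p $ None"
proof -
  show *: "mink p p = -1" "p $ None > 0" using assms by (auto simp: hyperboloid_def)
  then have "(norm (space_part p))\<^sup>2 < (p $ None)\<^sup>2" using mink_self_space_part[of p] by simp
  with * show "norm (space_part p) < p $ None" by (simp add: power2_less_imp_less)
qed

text \<open>
  The tangent space of the hyperboloid is positive definite. Orthogonality to \<open>p\<close> bounds the time
  coordinate by Cauchy-Schwarz in the space coordinates, with room to spare because the space part of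
  \<open>p\<close> is shorter than its time part.
\<close>

lemma orthogonal_timelike:
  assumes p: "p \<in> hyperboloid" and x: "mink x p = 0"
  shows "mink x x \<ge> 0" "mink x x = 0 \<Longrightarrow> x = 0"
proof -
  define a where "a = norm (space_part x)"
  define b where "b = norm (space_part p)"
  have p1: "b\<^sup>2 = (p $ None)\<^sup>2 - 1"
    using hyperboloidD(1)[OF p] by (simp add: mink_self_space_part b_def)
  have "\<bar>x $ None * p $ None\<bar> \<le> a * b"
    using x Cauchy_Schwarz_ineq2[of "space_part x" "space_part p"] by (simp add: mink_space_part a_def b_def)
  then have "(x $ None * p $ None)\<^sup>2 \<le> (a * b)\<^sup>2"
    by (metis abs_ge_zero power2_abs power_mono)
  then have k: "(x $ None)\<^sup>2 * (p $ None)\<^sup>2 \<le> a\<^sup>2 * (p $ None)\<^sup>2 - a\<^sup>2"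
    by (simp add: power_mult_distrib p1 algebra_simps)
  have P: "(p $ None)\<^sup>2 > 0" using hyperboloidD(2)[OF p] by simp
  have q: "mink x x = a\<^sup>2 - (x $ None)\<^sup>2" by (simp add: mink_self_space_part a_def)
  have k': "a\<^sup>2 \<le> mink x x * (p $ None)\<^sup>2" using k by (simp add: q algebra_simps)
  then have "mink x x * (p $ None)\<^sup>2 \<ge> 0" using zero_le_power2[of a] by linarith
  then show "mink x x \<ge> 0" using P by (simp add: zero_le_mult_iff)
  assume 0: "mink x x = 0"
  then have "a = 0" using k' by simp
  then show "x = 0" using 0 q by (intro minkowski_zeroI) (auto simp: a_def)
qed

text \<open>
  The reversed Cauchy-Schwarz inequality; \<open>- mink x y\<close> is the hyperbolic cosine of the distance.
\<close>

lemma mink_hyperboloid_le: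
  assumes x: "x \<in> hyperboloid" and y: "y \<in> hyperboloid"
  shows "mink x y \<le> -1"
proof -
  let ?z = "x + mink x y *\<^sub>R y"
  have "mink ?z y = 0" using hyperboloidD(1)[OF y] by (simp add: mink_bilinear)
  then have "mink ?z ?z \<ge> 0" by (rule orthogonal_timelike(1)[OF y])
  then have 1: "(mink x y)\<^sup>2 \<ge> 1"
    using hyperboloidD(1)[OF x] hyperboloidD(1)[OF y]
    by (simp add: mink_bilinear mink_commute[of y x] power2_eq_square)
  have "inner (space_part x) (space_part y) \<le> norm (space_part x) * norm (space_part y)"
    by (rule norm_cauchy_schwarz)
  also have "\<dots> < x $ None * y $ None"
    using hyperboloidD(2,3)[OF x] hyperboloidD(3)[OF y]
    by (intro mult_strict_mono') auto
  finally have "mink x y < 0" by (simp add: mink_space_part)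
  moreover have "\<bar>mink x y\<bar> \<ge> 1" using 1 abs_le_square_iff[of 1 "mink x y"] by simp
  ultimately show ?thesis by simp
qed

section \<open>Reflections in roots\<close>

definition refl :: "('n::finite) minkowski \<Rightarrow> 'n mink_matrix" where
  "refl e = matrix (\<lambda>x. x - (2 * mink x e / mink e e) *\<^sub>R e)"

lemma refl_apply: "refl e *v x = x - (2 * mink x e / mink e e) *\<^sub>R e"
proof -
  have "linear (\<lambda>x. x - (2 * mink x e / mink e e) *\<^sub>R e)"
    by (rule linearI) (simp_all add: mink_bilinear algebra_simps add_divide_distrib)
  then show ?thesis by (simp add: refl_def matrix_works)
qed

lemma refl_unit: "mink e e = 1 \<Longrightarrow> refl e *v x = x - (2 * mink x e) *\<^sub>R e"
  by (simp add: refl_apply)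

lemma is_reflection_refl: "mink e e > 0 \<Longrightarrow> is_reflection (refl e)"
  unfolding is_reflection_def by (auto simp: refl_apply)

lemma refl_scaleR: "t \<noteq> 0 \<Longrightarrow> refl (t *\<^sub>R e) = refl e"
  by (simp add: matrix_eq refl_apply mink_bilinear)

lemma refl_minus: "refl (- e) = refl e"
  using refl_scaleR[of "-1" e] by simp

lemma is_reflection_iff: "is_reflection A \<longleftrightarrow> (\<exists>e. mink e e = 1 \<and> A = refl e)"
proof
  assume "is_reflection A"
  then obtain e where e: "mink e e > 0" and A: "\<And>x. A *v x = x - (2 * mink x e / mink e e) *\<^sub>R e"
    by (auto simp: is_reflection_def)
  let ?u = "(1 / sqrt (mink e e)) *\<^sub>R e"
  have "mink ?u ?u = 1" using e by (simp add: mink_bilinear)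
  moreover have "A = refl ?u" using e A by (simp add: refl_scaleR) (simp add: matrix_eq refl_apply)
  ultimately show "\<exists>e. mink e e = 1 \<and> A = refl e" by blast
qed (auto intro: is_reflection_refl)

lemma refl_in_Isom: "mink e e > 0 \<Longrightarrow> refl e \<in> carrier Isom"
  by (intro reflection_in_Isom is_reflection_refl)

lemma refl_refl_apply: "mink e e \<noteq> 0 \<Longrightarrow> refl e *v (refl e *v x) = x"
  by (simp add: refl_apply mink_bilinear flip: scaleR_add_left)

lemma refl_refl: "mink e e \<noteq> 0 \<Longrightarrow> refl e ** refl e = mat 1"
  by (simp add: matrix_eq refl_refl_apply flip: matrix_vector_mul_assoc)

lemma refl_self: "mink e e \<noteq> 0 \<Longrightarrow> refl e *v e = - e"
  by (simp add: refl_apply) (metis add_diff_cancel_left' diff_minus_eq_add mult_2 scaleR_2 scaleR_one minus_diff_eq)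

lemma IsomD: "A \<in> carrier Isom \<Longrightarrow> mink (A *v x) (A *v y) = mink x y"
  by (simp add: carrier_Isom_iff)

lemma Isom_hyperboloid: "A \<in> carrier Isom \<Longrightarrow> x \<in> hyperboloid \<Longrightarrow> A *v x \<in> hyperboloid"
  by (auto simp: carrier_Isom_iff)

lemma refl_conj:
  assumes "A \<in> carrier Isom"
  shows "refl (A *v e) ** A = A ** refl e"
  by (simp add: matrix_eq refl_apply IsomD[OF assms] matrix_vector_mult_diff_distrib
      matrix_vector_mult_scaleR flip: matrix_vector_mul_assoc)

lemma refl_eq_imp:
  assumes "mink e e = 1" "mink f f = 1" "refl e = refl f"
  shows "e = f \<or> e = - f"
proof -
  have "- e = e - (2 * mink e f) *\<^sub>R f"
    using refl_self[of e] refl_unit[OF assms(2), of e] assms by simp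
  then have "2 *\<^sub>R e = 2 *\<^sub>R (mink e f *\<^sub>R f)" by (simp add: algebra_simps scaleR_2)
  then have e: "e = mink e f *\<^sub>R f" by (rule scaleR_left_imp_eq[rotated]) simp
  then have "mink e e = (mink e f)\<^sup>2" using assms(2)
    by (metis mink_scaleR(2) power2_eq_square)
  then have "mink e f = 1 \<or> mink e f = -1" using assms(1) by (simp add: power2_eq_1_iff)
  with e show ?thesis by auto
qed

section \<open>Discrete groups\<close>

interpretation Isom: group Isom
  by (rule group_Isom)

lemma Isom_inv: "A \<in> carrier Isom \<Longrightarrow> inv\<^bsub>Isom\<^esub> A ** A = mat 1" "A \<in> carrier Isom \<Longrightarrow> A ** inv\<^bsub>Isom\<^esub> A = mat 1"
  using Isom.l_inv[of A] Isom.r_inv[of A] by simp_all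

lemma Isom_inv_apply: 
  assumes "A \<in> carrier Isom" 
  shows "inv\<^bsub>Isom\<^esub> A *v (A *v x) = x" "A *v (inv\<^bsub>Isom\<^esub> A *v x) = x"
  using assms by (simp_all add: Isom_inv matrix_vector_mul_assoc)

lemma mink_inv: "A \<in> carrier Isom \<Longrightarrow> mink (inv\<^bsub>Isom\<^esub> A *v x) y = mink x (A *v y)"
  using IsomD[of A "inv\<^bsub>Isom\<^esub> A *v x" y] by (simp add: Isom_inv_apply)

lemma Isom_inv_refl: "mink e e > 0 \<Longrightarrow> inv\<^bsub>Isom\<^esub> (refl e) = refl e"
  by (rule Isom.inv_equality) (simp_all add: refl_refl refl_in_Isom)

lemma subgroup_closed:
  assumes "subgroup G Isom"
  shows "A \<in> G \<Longrightarrow> B \<in> G \<Longrightarrow> A ** B \<in> G" "mat 1 \<in> G" "A \<in> G \<Longrightarrow> A \<in> carrier Isom"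
    "A \<in> G \<Longrightarrow> inv\<^bsub>Isom\<^esub> A \<in> G"
  using subgroup.m_closed[OF assms] subgroup.one_closed[OF assms] subgroup.mem_carrier[OF assms]
   subgroup.m_inv_closed[OF assms] by auto

definition roots :: "('n::finite) mink_matrix set \<Rightarrow> 'n minkowski set" where
  "roots G = {e. mink e e = 1 \<and> refl e \<in> G}"

lemma rootsD: "e \<in> roots G \<Longrightarrow> mink e e = 1" "e \<in> roots G \<Longrightarrow> refl e \<in> G"
  by (auto simp: roots_def)

lemma roots_minus: "e \<in> roots G \<Longrightarrow> - e \<in> roots G"
  by (simp add: roots_def mink_minus refl_minus)

lemma refl_mult:
  assumes "A \<in> carrier Isom"
  shows "refl (A *v e) = A ** refl e ** inv\<^bsub>Isom\<^esub> A"
proof -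
  have "refl (A *v e) = refl (A *v e) ** A ** inv\<^bsub>Isom\<^esub> A"
    using assms by (simp add: Isom_inv flip: matrix_mul_assoc)
  then show ?thesis using refl_conj[OF assms] by simp
qed

lemma roots_mult:
  assumes G: "subgroup G Isom" and A: "A \<in> G" and e: "e \<in> roots G"
  shows "A *v e \<in> roots G"
  using refl_mult[of A e] IsomD[of A e e] subgroup_closed[OF G] A e by (auto simp: roots_def)

definition mink_adjoint :: "('n::finite) mink_matrix \<Rightarrow> 'n mink_matrix" where
  "mink_adjoint A = matrix time_flip ** transpose A ** matrix time_flip"

text \<open>
  Inversion is given by a formula that is continuous on all matrices, so limits of isometries can be inverted.
\<close>

lemma Isom_inv_eq_adjoint:
  assumes A: "A \<in> carrier Isom"
  shows "inv\<^bsub>Isom\<^esub> A = mink_adjoint A"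
proof -
  have F: "matrix time_flip *v x = time_flip x" for x :: "'a minkowski"
  proof -
    have "linear (time_flip :: 'a minkowski \<Rightarrow> _)"
      by (rule linearI) (auto simp: time_flip_def vec_eq_iff split: option.split)
    then show ?thesis by (simp add: matrix_works)
  qed
  have "mink y (mink_adjoint A *v x) = mink y (inv\<^bsub>Isom\<^esub> A *v x)" for x y
  proof -
    have "mink y (mink_adjoint A *v x) = inner (time_flip y) (time_flip (transpose A *v time_flip x))"
      by (simp add: mink_adjoint_def mink_inner F flip: matrix_vector_mul_assoc)
    also have "\<dots> = inner y (transpose A *v time_flip x)"
      by (simp add: inner_vec_def sum_option time_flip_def)
    also have "\<dots> = inner (A *v y) (time_flip x)"
      by (metis dot_lmul_matrix transpose_matrix_vector transpose_transpose)
    also have "\<dots> = mink x (A *v y)" unfolding mink_inner by (rule inner_commute)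
    also have "\<dots> = mink (inv\<^bsub>Isom\<^esub> A *v x) y" using A by (simp add: mink_inv)
    finally show ?thesis by (simp add: mink_commute)
  qed
  then have "mink_adjoint A *v x = inv\<^bsub>Isom\<^esub> A *v x" for x
    using mink_nondegenerate[of "mink_adjoint A *v x - inv\<^bsub>Isom\<^esub> A *v x"]
    by (simp add: mink_commute mink_diff)
  then show ?thesis by (simp add: matrix_eq)
qed

lemma tendsto_matrix_mult:
  fixes A :: "nat \<Rightarrow> real ^ 'm::finite ^ 'k::finite" and B :: "nat \<Rightarrow> real ^ 'l::finite ^ 'm"
  assumes "A \<longlonglongrightarrow> a" "B \<longlonglongrightarrow> b"
  shows "(\<lambda>n. A n ** B n) \<longlonglongrightarrow> a ** b"
  unfolding matrix_matrix_mult_def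
  by (intro tendsto_vec_lambda tendsto_sum tendsto_mult tendsto_vec_nth assms)

text \<open>
  A bounded sequence of distinct elements would have a convergent subsequence; quotients of successive
  terms then tend to the identity, which is isolated, so the sequence would be eventually constant.
\<close>

lemma finite_discrete_bounded:
  fixes G :: "('n::finite) mink_matrix set"
  assumes G: "discrete_subgroup G"
  shows "finite {A \<in> G. norm A \<le> C}"
proof (rule ccontr)
  assume inf: "infinite {A \<in> G. norm A \<le> C}"
  have S: "subgroup G Isom" and D: "discrete G" using G by (auto simp: discrete_subgroup_def)
  have "compact (cball (0 :: 'n mink_matrix) C)" by simp
  then obtain l where "l islimpt {A \<in> G. norm A \<le> C}"
    using inf Heine_Borel_imp_Bolzano_Weierstrass[of "cball 0 C" "{A \<in> G. norm A \<le> C}"]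
    by (auto simp: subset_iff)
  then obtain A where A: "\<And>n. A n \<in> G" "\<And>n. A n \<noteq> l" "A \<longlonglongrightarrow> l"
    unfolding islimpt_sequential by blast
  have adj: "(\<lambda>n. mink_adjoint (A n)) \<longlonglongrightarrow> mink_adjoint l"
    unfolding mink_adjoint_def transpose_def
    by (intro tendsto_matrix_mult tendsto_vec_lambda tendsto_vec_nth tendsto_const A)
  have inv: "mink_adjoint (A n) = inv\<^bsub>Isom\<^esub> (A n)" for n
    using Isom_inv_eq_adjoint subgroup_closed(3)[OF S] A(1) by metis
  have one: "A n ** mink_adjoint (A n) = mat 1" for n
    using inv Isom_inv(2)[of "A n"] subgroup_closed(3)[OF S] A(1) by metis
  have "(\<lambda>n. A n ** mink_adjoint (A n)) \<longlonglongrightarrow> l ** mink_adjoint l"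
    by (rule tendsto_matrix_mult[OF A(3) adj])
  then have l1: "l ** mink_adjoint l = mat 1"
    by (simp add: one LIMSEQ_const_iff)
  have lim: "(\<lambda>n. A (Suc n) ** mink_adjoint (A n)) \<longlonglongrightarrow> mat 1"
    using tendsto_matrix_mult[OF LIMSEQ_Suc[OF A(3)] adj] by (simp add: l1)
  obtain T where T: "open T" "T \<inter> G = {mat 1}"
    using discreteD[OF D subgroup_closed(2)[OF S]] by (auto simp: isolated_in_def)
  have "eventually (\<lambda>n. A (Suc n) ** mink_adjoint (A n) \<in> T) sequentially"
    using topological_tendstoD[OF lim T(1)] T(2) by auto
  then obtain N where N: "\<And>n. n \<ge> N \<Longrightarrow> A (Suc n) ** mink_adjoint (A n) \<in> T"
    by (auto simp: eventually_sequentially)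
  have "A (Suc n) = A n" if "n \<ge> N" for n
  proof -
    have "A (Suc n) ** mink_adjoint (A n) \<in> G"
      using inv A(1) subgroup_closed[OF S] by metis
    then have "A (Suc n) ** mink_adjoint (A n) = mat 1" using N[OF that] T(2) by blast
    then have "A (Suc n) ** (mink_adjoint (A n) ** A n) = A n"
      by (simp add: matrix_mul_assoc)
    moreover have "mink_adjoint (A n) ** A n = mat 1" using one matrix_left_right_inverse by metis
    ultimately show ?thesis by simp
  qed
  note eventually_step = this
  have "A n = A N" if "n \<ge> N" for n
    using that
  proof (induction rule: dec_induct)
    case (step m)
    then show ?case using eventually_step[of m] by simp
  qed simp
  then have "\<forall>\<^sub>F n in sequentially. A n = A N" by (rule eventually_sequentiallyI)
  then have "A \<longlonglongrightarrow> A N" by (rule tendsto_eventually)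
  with A(3) have "l = A N" by (rule LIMSEQ_unique)
  with A(2) show False by metis
qed

text \<open>
  For unit vectors the entries of \<open>refl e\<close> are quadratic in \<open>e\<close>, and \<open>refl e\<close> determines \<open>e\<close> up to sign.
\<close>

lemma finite_roots_norm:
  fixes G :: "('n::finite) mink_matrix set"
  assumes G: "discrete_subgroup G"
  shows "finite {e \<in> roots G. norm e \<le> C}"
proof -
  define X where "X = {e \<in> roots G. norm e \<le> C}"
  define B where "B = (\<Sum>i\<in>(UNIV :: 'n option set). \<Sum>j\<in>(UNIV :: 'n option set). 1 + 2 * norm (time_flip (axis j (1::real))) * C * C)"
  have "norm (refl e) \<le> B" if e: "e \<in> X" for e
  proof -
    have u: "mink e e = 1" and n: "norm e \<le> C" using e by (auto simp: X_def roots_def)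
    have "\<bar>refl e $ i $ j\<bar> \<le> 1 + 2 * norm (time_flip (axis j (1::real))) * C * C" for i j
    proof -
      have "refl e $ i $ j = (refl e *v axis j 1) $ i"
        by (simp add: matrix_vector_mult_basis column_def)
      also have "\<dots> = axis j 1 $ i - 2 * mink (axis j 1) e * e $ i"
        by (simp add: refl_unit[OF u])
      finally have "\<bar>refl e $ i $ j\<bar> \<le> \<bar>axis j 1 $ i :: real\<bar> + 2 * \<bar>mink (axis j 1) e\<bar> * \<bar>e $ i\<bar>"
        by (simp add: abs_mult) (metis abs_mult abs_numeral abs_triangle_ineq4)
      also have "\<dots> \<le> 1 + 2 * (norm (time_flip (axis j (1::real))) * C) * C"
      proof (intro add_mono mult_mono)
        show "\<bar>mink (axis j 1) e\<bar> \<le> norm (time_flip (axis j (1::real))) * C"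
          unfolding mink_inner using n
          by (intro order_trans[OF Cauchy_Schwarz_ineq2] mult_left_mono) auto
        show "\<bar>e $ i\<bar> \<le> C" using n component_le_norm_cart[of e i] by simp
        show "0 \<le> 2 * (norm (time_flip (axis j (1::real))) * C)"
          using order_trans[OF norm_ge_zero n] by (intro mult_nonneg_nonneg) auto
      qed (auto simp: axis_def)
      finally show ?thesis by (simp add: mult.assoc)
    qed note entry = this
    have "norm (refl e) \<le> (\<Sum>i\<in>UNIV. norm (refl e $ i))"
      unfolding norm_vec_def[of "refl e"] by (rule L2_set_le_sum) simp
    also have "\<dots> \<le> (\<Sum>i\<in>UNIV. \<Sum>j\<in>UNIV. \<bar>refl e $ i $ j\<bar>)"
      by (intro sum_mono norm_le_l1_cart)
    also have "\<dots> \<le> B" unfolding B_def by (intro sum_mono entry)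
    finally show ?thesis .
  qed
  then have "refl ` X \<subseteq> {A \<in> G. norm A \<le> B}" by (auto simp: X_def roots_def)
  then have fin: "finite (refl ` X)" using finite_discrete_bounded[OF G] finite_subset by blast
  have fib: "finite (refl -` {A} \<inter> X)" for A
  proof (cases "\<exists>f\<in>X. refl f = A")
    case True
    then obtain f where f: "f \<in> X" "refl f = A" by blast
    then have "refl -` {A} \<inter> X \<subseteq> {f, - f}"
      using refl_eq_imp[of _ f] by (auto simp: X_def roots_def)
    then show ?thesis using finite_subset by blast
  next
    case False
    then have "refl -` {A} \<inter> X = {}" by blast
    then show ?thesis by simp
  qed
  have "X \<subseteq> refl -` (refl ` X) \<inter> X" by blast
  then have "finite X" using finite_finite_vimage_IntI[OF fin fib] by (rule finite_subset)
  then show ?thesis by (simp add: X_def)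
qed

text \<open>
  For a point \<open>p\<close> of the hyperboloid, \<open>mink p e\<close> is the hyperbolic sine of the distance to the
  mirror. The lemma says that mirrors are locally finite: as \<open>p\<close> is timelike, a bound on \<open>mink p e\<close>
  bounds the time coordinate of \<open>e\<close>.
\<close>

lemma finite_roots_bounded:
  fixes G :: "('n::finite) mink_matrix set"
  assumes G: "discrete_subgroup G" and p: "p \<in> hyperboloid"
  shows "finite {e \<in> roots G. \<bar>mink p e\<bar> \<le> C}"
proof -
  define a where "a = norm (space_part p)"
  define P where "P = p $ None"
  define T where "T = (C + a) / (P - a)"
  have aP: "0 \<le> a" "a < P" using hyperboloidD[OF p] by (auto simp: a_def P_def)
  have "norm e \<le> sqrt (1 + 2 * T\<^sup>2)" if e: "e \<in> roots G" "\<bar>mink p e\<bar> \<le> C" for e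
  proof -
    define w where "w = norm (space_part e)"
    define t where "t = e $ None"
    have w2: "w\<^sup>2 = 1 + t\<^sup>2"
      using rootsD(1)[OF e(1)] by (simp add: mink_self_space_part w_def t_def)
    have "w\<^sup>2 \<le> (1 + \<bar>t\<bar>)\<^sup>2" unfolding w2 by (simp add: power2_eq_square algebra_simps)
    then have w: "w \<le> 1 + \<bar>t\<bar>" by (rule power2_le_imp_le) simp
    have "P * \<bar>t\<bar> = \<bar>inner (space_part p) (space_part e) - mink p e\<bar>"
      using aP by (simp add: mink_space_part abs_mult P_def t_def)
    also have "\<dots> \<le> a * w + C"
      using Cauchy_Schwarz_ineq2[of "space_part p" "space_part e"] e(2) by (simp add: a_def w_def)
    also have "\<dots> \<le> a * (1 + \<bar>t\<bar>) + C" using mult_left_mono[OF w aP(1)] by simp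
    finally have "\<bar>t\<bar> * (P - a) \<le> C + a" by (simp add: algebra_simps)
    then have tT: "\<bar>t\<bar> \<le> T" using aP by (simp add: T_def pos_le_divide_eq)
    have "(norm e)\<^sup>2 = w\<^sup>2 + t\<^sup>2"
      by (simp add: power2_norm_eq_inner w_def t_def)
        (simp add: inner_vec_def sum_option space_part_def power2_eq_square)
    also have "\<dots> \<le> 1 + 2 * T\<^sup>2" using w2 power_mono[OF tT, of 2] by simp
    finally show ?thesis by (simp add: real_le_rsqrt)
  qed
  then have "{e \<in> roots G. \<bar>mink p e\<bar> \<le> C} \<subseteq> {e \<in> roots G. norm e \<le> sqrt (1 + 2 * T\<^sup>2)}"
    by blast
  then show ?thesis using finite_roots_norm[OF G] finite_subset by blast
qed

section \<open>Polynomials and Zariski closures\<close>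

lemma polynomial_on_line_eq_0:
  fixes F :: "'a::real_normed_vector \<Rightarrow> real"
  assumes F: "real_polynomial_function F" and inf: "infinite {x. F (a + x *\<^sub>R b) = 0}"
  shows "F (a + y *\<^sub>R b) = 0"
proof -
  have "polynomial_function (\<lambda>x. a + x *\<^sub>R b)"
    by (intro polynomial_function_add polynomial_function_const polynomial_function_bounded_linear
        bounded_linear_scaleR_left)
  then have "real_polynomial_function (F \<circ> (\<lambda>x. a + x *\<^sub>R b))"
    using F by (rule real_polynomial_function_compose)
  then obtain c n where c: "(F \<circ> (\<lambda>x. a + x *\<^sub>R b)) = (\<lambda>x. \<Sum>i\<le>n. c i * x^i)"
    using real_polynomial_function_imp_sum by blast
  then have c: "F (a + x *\<^sub>R b) = (\<Sum>i\<le>n. c i * x^i)" for x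
    by (metis comp_apply)
  have "\<forall>k\<le>n. c k = 0" using inf polyfun_finite_roots[of c n] by (auto simp: c)
  then show ?thesis by (simp add: c)
qed

lemma open_nonempty_infinite:
  fixes X :: "real set"
  assumes "open X" "x \<in> X"
  shows "infinite X"
  using assms finite_imp_not_open[of X] by auto

text \<open>
  Clearing denominators, for use with rational maps whose denominator is a known polynomial.
\<close>

lemma homogenise_polynomial:
  fixes f :: "'a::real_normed_vector \<Rightarrow> real"
  assumes "real_polynomial_function f"
  shows "\<exists>D F. real_polynomial_function F \<and> (\<forall>x t. t \<noteq> 0 \<longrightarrow> F (x, t) = t ^ D * f ((1 / t) *\<^sub>R x))"
  using assms
proof (induction f rule: real_polynomial_function.induct)
  case (linear f)
  have 1: "real_polynomial_function (\<lambda>z :: 'a \<times> real. f (fst z))"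
    using bounded_linear_compose[OF linear bounded_linear_fst] by blast
  have 2: "t ^ 1 * f ((1 / t) *\<^sub>R x) = f x" if "t \<noteq> 0" for x and t :: real
    using that linear_scale[OF bounded_linear.linear[OF linear]] by simp
  show ?case
    by (rule exI[of _ 1], rule exI, rule conjI[OF 1]) (metis 2 fst_conv)
next
  case (const c)
  show ?case by (rule exI[of _ 0], rule exI[of _ "\<lambda>_. c"]) auto
next
  case (add f g)
  then obtain D F E G where
    "real_polynomial_function F" "\<forall>x t. t \<noteq> 0 \<longrightarrow> F (x, t) = t ^ D * f ((1 / t) *\<^sub>R x)"
    "real_polynomial_function G" "\<forall>x t. t \<noteq> 0 \<longrightarrow> G (x, t) = t ^ E * g ((1 / t) *\<^sub>R x)"
    by blast
  moreover have "real_polynomial_function (\<lambda>z :: 'a \<times> real. snd z ^ k)" for k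
    using real_polynomial_function_power bounded_linear_snd by blast
  ultimately show ?case
    by (intro exI[of _ "D + E"] exI[of _ "\<lambda>z. snd z ^ E * F z + snd z ^ D * G z"])
      (simp add: power_add algebra_simps real_polynomial_function.intros(3,4))
next
  case (mult f g)
  then obtain D F E G where
    "real_polynomial_function F" "\<forall>x t. t \<noteq> 0 \<longrightarrow> F (x, t) = t ^ D * f ((1 / t) *\<^sub>R x)"
    "real_polynomial_function G" "\<forall>x t. t \<noteq> 0 \<longrightarrow> G (x, t) = t ^ E * g ((1 / t) *\<^sub>R x)"
    by blast
  then show ?case
    by (intro exI[of _ "D + E"] exI[of _ "\<lambda>z. F z * G z"]) (auto simp: power_add)
qed

lemma polynomial_function_vec:
  fixes f :: "'a::real_normed_vector \<Rightarrow> ('b::euclidean_space) ^ 'k::finite"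
  assumes "\<And>i. polynomial_function (\<lambda>x. f x $ i)"
  shows "polynomial_function f"
  using assms unfolding polynomial_function_iff_Basis_inner
  by (auto simp: Basis_vec_def inner_axis)

text \<open>
  The entries of \<open>mink v v *\<^sub>R refl v\<close> are quadratic in \<open>v\<close>, so an algebraic condition on \<open>refl v\<close>
  becomes one on \<open>v\<close>.
\<close>

lemma polynomial_refl:
  fixes f :: "('n::finite) mink_matrix \<Rightarrow> real"
  assumes f: "real_polynomial_function f"
  obtains F where "real_polynomial_function F" "\<And>v. mink v v \<noteq> 0 \<Longrightarrow> F v = 0 \<longleftrightarrow> f (refl v) = 0"
proof -
  obtain D F where F: "real_polynomial_function F"
    "\<And>x t. t \<noteq> 0 \<Longrightarrow> F (x, t) = t ^ D * f ((1 / t) *\<^sub>R x)"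
    using homogenise_polynomial[OF f] by blast
  define N :: "'n minkowski \<Rightarrow> 'n mink_matrix" where
    "N v = (\<chi> i j. mink v v * (if i = j then 1 else 0) - 2 * mink (axis j 1) v * v $ i)" for v
  have entry: "refl v $ i $ j = (if i = j then 1 else 0) - 2 * mink (axis j 1) v / mink v v * v $ i" for v :: "'n minkowski" and i j
  proof -
    have "refl v $ i $ j = (refl v *v axis j 1) $ i"
      by (simp add: matrix_vector_mult_basis column_def)
    then show ?thesis by (simp add: refl_apply axis_def)
  qed
  have N: "(1 / mink v v) *\<^sub>R N v = refl v" if "mink v v \<noteq> 0" for v
    using that by (simp add: vec_eq_iff entry N_def field_simps)
  have "polynomial_function (\<lambda>v. N v $ i $ j)" for i j
  proof -
    have "real_polynomial_function (\<lambda>v :: 'n minkowski. v $ i)"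
      using bounded_linear_vec_nth by blast
    moreover have "real_polynomial_function (\<lambda>v :: 'n minkowski. mink v v)"
      "real_polynomial_function (\<lambda>v :: 'n minkowski. mink (axis j 1) v)"
      by (rule real_polynomial_mink; simp)+
    ultimately have "real_polynomial_function
        (\<lambda>v. mink v v * (if i = j then 1 else 0) - 2 * mink (axis j 1) v * v $ i)"
      by (intro real_polynomial_function_diff real_polynomial_function.intros(2,4))
    then show ?thesis by (simp add: N_def real_polynomial_function_eq)
  qed
  then have "polynomial_function N" by (intro polynomial_function_vec)
  moreover have "polynomial_function (\<lambda>v :: 'n minkowski. mink v v)"
    unfolding real_polynomial_function_eq[symmetric] by (intro real_polynomial_mink) auto
  ultimately have "polynomial_function (\<lambda>v. (N v, mink v v))"
    unfolding polynomial_function_iff_Basis_inner by (auto simp: Basis_prod_def)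
  then have "real_polynomial_function (F \<circ> (\<lambda>v. (N v, mink v v)))"
    using F(1) by (rule real_polynomial_function_compose)
  moreover have "(F \<circ> (\<lambda>v. (N v, mink v v))) v = 0 \<longleftrightarrow> f (refl v) = 0" if "mink v v \<noteq> 0" for v
    using that F(2)[OF that] N[OF that] by simp
  ultimately show thesis by (rule that)
qed

text \<open>
  In contrast to \<open>zariski_closure\<close>, the ambient space is that of all matrices; multiplication by
  a fixed matrix is linear there, whence \<open>zariski_hull_mult\<close>.
\<close>

definition zariski_hull :: "('n::finite) mink_matrix set \<Rightarrow> 'n mink_matrix set" where
  "zariski_hull S = {A. \<forall>f. PO_regular f \<and> (\<forall>B\<in>S. f B = 0) \<longrightarrow> f A = 0}"

lemma zariski_hullI:
  "(\<And>f. PO_regular f \<Longrightarrow> (\<And>B. B \<in> S \<Longrightarrow> f B = 0) \<Longrightarrow> f A = 0) \<Longrightarrow> A \<in> zariski_hull S"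
  by (simp add: zariski_hull_def)

lemma zariski_hullD:
  "A \<in> zariski_hull S \<Longrightarrow> PO_regular f \<Longrightarrow> (\<And>B. B \<in> S \<Longrightarrow> f B = 0) \<Longrightarrow> f A = 0"
  by (simp add: zariski_hull_def)

lemma zariski_hull_incl: "S \<subseteq> zariski_hull S"
  by (auto simp: zariski_hull_def)

lemma zariski_hull_mono: "S \<subseteq> T \<Longrightarrow> zariski_hull S \<subseteq> zariski_hull T"
  unfolding zariski_hull_def by blast

lemma zariski_dense_iff: "zariski_dense S \<longleftrightarrow> S \<subseteq> carrier Isom \<and> carrier Isom \<subseteq> zariski_hull S"
  unfolding zariski_dense_def zariski_closure_def zariski_hull_def by blast

lemma PO_regular_compose_linear:
  fixes g :: "('n::finite) mink_matrix \<Rightarrow> 'n mink_matrix"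
  assumes f: "PO_regular f" and g: "linear g"
  shows "PO_regular (\<lambda>A. f (g A))"
proof -
  have "real_polynomial_function (f \<circ> g)"
    using f g by (intro real_polynomial_function_compose polynomial_function_bounded_linear)
      (auto simp: PO_regular_def linear_conv_bounded_linear)
  then show ?thesis using f linear_neg[OF g] by (simp add: PO_regular_def o_def)
qed

lemma linear_matrix_mult:
  "linear (\<lambda>X. (A :: real ^ 'm::finite ^ 'k::finite) ** (X :: real ^ 'l::finite ^ 'm))"
  "linear (\<lambda>X. (X :: real ^ 'm ^ 'k) ** (B :: real ^ 'l ^ 'm))"
  by (auto intro!: linearI simp: matrix_matrix_mult_def vec_eq_iff sum.distrib algebra_simps sum_distrib_left)

text \<open>
  The usual two-step argument: first move a fixed element of \<open>S\<close> to one side, then a fixed element of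
  the closure to the other.
\<close>

lemma zariski_hull_mult:
  assumes S: "\<And>A B. A \<in> S \<Longrightarrow> B \<in> S \<Longrightarrow> A ** B \<in> S"
    and A: "A \<in> zariski_hull S" and B: "B \<in> zariski_hull S"
  shows "A ** B \<in> zariski_hull S"
proof (rule zariski_hullI)
  fix f assume f: "PO_regular f" and f0: "\<And>B. B \<in> S \<Longrightarrow> f B = 0"
  have *: "f (C ** B) = 0" if "C \<in> S" for C
    using zariski_hullD[OF B PO_regular_compose_linear[OF f linear_matrix_mult(1)[of C]]] S f0 that
    by blast
  show "f (A ** B) = 0"
    by (rule zariski_hullD[OF A PO_regular_compose_linear[OF f linear_matrix_mult(2)[of B]] *])
qed

lemma refl_line_in_hull:
  assumes inf: "infinite {x. mink (a + x *\<^sub>R b) (a + x *\<^sub>R b) > 0 \<and> refl (a + x *\<^sub>R b) \<in> zariski_hull S}"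
    and y: "mink (a + y *\<^sub>R b) (a + y *\<^sub>R b) > 0"
  shows "refl (a + y *\<^sub>R b) \<in> zariski_hull S"
proof (rule zariski_hullI)
  fix f assume f: "PO_regular f" and f0: "\<And>B. B \<in> S \<Longrightarrow> f B = 0"
  obtain F where F: "real_polynomial_function F" "\<And>v. mink v v \<noteq> 0 \<Longrightarrow> F v = 0 \<longleftrightarrow> f (refl v) = 0"
    using polynomial_refl[of f] f unfolding PO_regular_def by blast
  have "{x. mink (a + x *\<^sub>R b) (a + x *\<^sub>R b) > 0 \<and> refl (a + x *\<^sub>R b) \<in> zariski_hull S}
     \<subseteq> {x. F (a + x *\<^sub>R b) = 0}"
    using F(2) zariski_hullD[OF _ f f0] by auto
  then have "F (a + y *\<^sub>R b) = 0"
    using inf finite_subset by (intro polynomial_on_line_eq_0[OF F(1)]) blast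
  then show "f (refl (a + y *\<^sub>R b)) = 0" using F(2) y by auto
qed

section \<open>Dihedral groups of ultraparallel mirrors\<close>

text \<open>
  The translation \<open>refl c ** refl u\<close> acts on the lines of the plane of \<open>c\<close> and \<open>u\<close>; in the affine
  coordinate \<open>r\<close> of the line of \<open>c - r *\<^sub>R u\<close> it is the Moebius map \<open>r \<mapsto> s / m\<close>. Below the smaller
  of its two fixed points, the roots of \<open>1 - 2 * k * r + r\<^sup>2\<close>, it moves every point up,
  \<open>r < s / m\<close>; the bound \<open>r < k\<close>, the midpoint of the roots, singles out this branch.
\<close>

lemma ultraparallel_step:
  fixes c u :: "('n::finite) minkowski"
  assumes c: "mink c c = 1" and u: "mink u u = 1" and k: "mink c u = k" "k > 1" and r: "r < k"
  defines "s \<equiv> 2 * k - r"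
  defines "m \<equiv> 2 * k * s - 1"
  shows "refl c *v (refl u *v (c - r *\<^sub>R u)) = m *\<^sub>R (c - (s / m) *\<^sub>R u)"
    and "m > 0" "0 < s / m" "s / m < k"
    and "1 - 2 * k * r + r\<^sup>2 > 0 \<Longrightarrow> r < s / m"
proof -
  have s: "s > k" using r by (simp add: s_def)
  have "k * s > 1 * 1" using k(2) s by (intro mult_strict_mono) auto
  then show m: "m > 0" by (simp add: m_def)
  show "0 < s / m" using s m k(2) by simp
  have "refl u *v (c - r *\<^sub>R u) = c - s *\<^sub>R u"
    by (simp add: refl_unit[OF u] mink_bilinear k u s_def algebra_simps flip: scaleR_add_left)
  moreover have "refl c *v (c - s *\<^sub>R u) = m *\<^sub>R c - s *\<^sub>R u"
    by (simp add: refl_unit[OF c] mink_bilinear k c mink_commute[of u c] m_def vec_eq_iff algebra_simps)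
  ultimately show "refl c *v (refl u *v (c - r *\<^sub>R u)) = m *\<^sub>R (c - (s / m) *\<^sub>R u)"
    using m by (simp add: scaleR_diff_right)
  have "k * m - s = 2 * (k\<^sup>2 - 1) * s + (s - k)"
    by (simp add: m_def algebra_simps power2_eq_square)
  moreover have "k\<^sup>2 > 1" using k(2) by (simp add: power2_eq_square less_1_mult)
  then have "(k\<^sup>2 - 1) * s > 0" using s k(2) by (intro mult_pos_pos) auto
  ultimately have "k * m - s > 0" using s by linarith
  then show "s / m < k" using m by (simp add: pos_divide_less_eq)
  assume q: "1 - 2 * k * r + r\<^sup>2 > 0"
  have "s - r * m = 2 * k * (1 - 2 * k * r + r\<^sup>2)"
    by (simp add: s_def m_def algebra_simps power2_eq_square)
  then have "s - r * m > 0" using q k(2) by simp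
  then show "r < s / m" using m by (simp add: pos_less_divide_eq)
qed

text \<open>
  The translation has infinite order, seen already on the coordinate of the first normal: it starts at
  \<open>0\<close> and is positive from then on.
\<close>

lemma ultraparallel_power_neq:
  fixes c u :: "('n::finite) minkowski"
  assumes c: "mink c c = 1" and u: "mink u u = 1" and k: "\<bar>mink c u\<bar> > 1"
  shows "((\<lambda>x. refl c *v (refl u *v x)) ^^ Suc n) c \<noteq> c"
proof -
  \<comment> \<open>changing the sign of a root does not change its reflection\<close>
  have main: "((\<lambda>x. refl c *v (refl u *v x)) ^^ Suc n) c \<noteq> c"
    if u: "mink u u = 1" and k: "mink c u > 1" for u
  proof -
    have lin: "refl c *v (refl u *v (l *\<^sub>R v)) = l *\<^sub>R (refl c *v (refl u *v v))" for l v
      by (simp add: matrix_vector_mult_scaleR)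
    have "\<exists>l r. l > 0 \<and> r > 0 \<and> r < mink c u \<and>
        ((\<lambda>x. refl c *v (refl u *v x)) ^^ Suc n) c = l *\<^sub>R (c - r *\<^sub>R u)" for n
    proof (induction n)
      case 0
      define s where "s = 2 * mink c u - 0"
      define m where "m = 2 * mink c u * s - 1"
      have "(0 :: real) < mink c u" using k by simp
      note st = ultraparallel_step[OF c u refl k this, folded s_def, folded m_def]
      have "((\<lambda>x. refl c *v (refl u *v x)) ^^ Suc 0) c = m *\<^sub>R (c - (s / m) *\<^sub>R u)"
        using st(1) by simp
      then show ?case using st(2-4) by blast
    next
      case (Suc n)
      then obtain l r where lr: "l > 0" "r > 0" "r < mink c u"
        "((\<lambda>x. refl c *v (refl u *v x)) ^^ Suc n) c = l *\<^sub>R (c - r *\<^sub>R u)" by blast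
      define s where "s = 2 * mink c u - r"
      define m where "m = 2 * mink c u * s - 1"
      note st = ultraparallel_step[OF c u refl k lr(3), folded s_def, folded m_def]
      have "((\<lambda>x. refl c *v (refl u *v x)) ^^ Suc (Suc n)) c = (l * m) *\<^sub>R (c - (s / m) *\<^sub>R u)"
        using lr(4) lin[of l] st(1) by simp
      then show ?case using st(2-4) lr(1) mult_pos_pos by blast
    qed
    then obtain l r where lr: "l > 0" "r > 0"
        "((\<lambda>x. refl c *v (refl u *v x)) ^^ Suc n) c = l *\<^sub>R (c - r *\<^sub>R u)" by blast
    show ?thesis
    proof
      assume "((\<lambda>x. refl c *v (refl u *v x)) ^^ Suc n) c = c"
      then have e: "l *\<^sub>R (c - r *\<^sub>R u) = c" using lr by simp
      have "mink c c = l * (1 - r * mink c u)" "mink c u = l * (mink c u - r)"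
        by (subst e[symmetric], simp add: mink_bilinear c u mink_commute[of u c])+
      then have m: "1 = l * (1 - r * mink c u)" "mink c u = l * (mink c u - r)"
        unfolding c by simp_all
      have "(1 - l) * (1 - (mink c u)\<^sup>2) = 0" using m by algebra
      moreover have "l \<noteq> 1" using m(2) lr(2) by auto
      ultimately have "(mink c u)\<^sup>2 = 1" by simp
      then show False using k by (simp add: power2_eq_1_iff)
    qed
  qed
  show ?thesis
  proof (cases "mink c u > 1")
    case True
    then show ?thesis by (rule main[OF u])
  next
    case False
    then have "mink c (- u) > 1" using k by (simp add: mink_minus)
    then show ?thesis using main[of "- u"] u by (simp add: mink_minus refl_minus)
  qed
qed

section \<open>Subspaces of mirrors in a Zariski closure\<close>

text \<open>
  The orbit of \<open>c\<close> under the translation meets infinitely many lines of the plane, so the polynomial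
  equations for \<open>refl w\<close> hold on an affine line of the plane, and by homogeneity on the whole plane.
\<close>

lemma ultraparallel_plane_in_hull:
  fixes c u :: "('n::finite) minkowski"
  assumes S: "\<And>A B. A \<in> S \<Longrightarrow> B \<in> S \<Longrightarrow> A ** B \<in> S"
    and c: "mink c c = 1" and u: "mink u u = 1" and k: "\<bar>mink c u\<bar> > 1"
    and Z: "refl c \<in> zariski_hull S" "refl u \<in> zariski_hull S"
    and w: "w \<in> span {c, u}" "mink w w > 0"
  shows "refl w \<in> zariski_hull S"
proof -
  have main: "refl (a *\<^sub>R c - b *\<^sub>R u) \<in> zariski_hull S"
    if u: "mink u u = 1" and k: "mink c u > 1" and Z: "refl u \<in> zariski_hull S"
      and w: "mink (a *\<^sub>R c - b *\<^sub>R u) (a *\<^sub>R c - b *\<^sub>R u) > 0" for a b u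
  proof -
    have q: "mink (c - r *\<^sub>R u) (c - r *\<^sub>R u) = 1 - 2 * mink c u * r + r\<^sup>2" for r
      by (simp add: mink_bilinear c u mink_commute[of u c] power2_eq_square algebra_simps)
    define X where "X = {r. r < mink c u \<and> mink (c - r *\<^sub>R u) (c - r *\<^sub>R u) > 0 \<and> refl (c - r *\<^sub>R u) \<in> zariski_hull S}"
    have step: "\<exists>r'\<in>X. r < r'" if "r \<in> X" for r
    proof -
      have r: "r < mink c u" "mink (c - r *\<^sub>R u) (c - r *\<^sub>R u) > 0" "refl (c - r *\<^sub>R u) \<in> zariski_hull S"
        using that by (auto simp: X_def)
      define s where "s = 2 * mink c u - r"
      define m where "m = 2 * mink c u * s - 1"
      note st = ultraparallel_step[OF c u HOL.refl k r(1), folded s_def, folded m_def]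
      let ?T = "refl c ** refl u"
      have T: "?T \<in> carrier Isom"
        using Isom.m_closed[OF refl_in_Isom[of c] refl_in_Isom[of u]] c u by simp
      have inv: "inv\<^bsub>Isom\<^esub> ?T = refl u ** refl c"
        using Isom.inv_mult_group[OF refl_in_Isom[of c] refl_in_Isom[of u]] c u by (simp add: Isom_inv_refl)
      have v: "?T *v (c - r *\<^sub>R u) = m *\<^sub>R (c - (s / m) *\<^sub>R u)"
        using st(1) by (simp add: matrix_vector_mul_assoc)
      have "mink (m *\<^sub>R (c - (s / m) *\<^sub>R u)) (m *\<^sub>R (c - (s / m) *\<^sub>R u)) > 0"
        using r(2) IsomD[OF T] unfolding v[symmetric] by simp
      then have pos: "mink (c - (s / m) *\<^sub>R u) (c - (s / m) *\<^sub>R u) > 0"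
        using st(2) by (simp add: mink_scaleR zero_less_mult_iff)
      have "refl (c - (s / m) *\<^sub>R u) = refl (?T *v (c - r *\<^sub>R u))"
        unfolding v using st(2) by (simp add: refl_scaleR)
      also have "\<dots> = ?T ** refl (c - r *\<^sub>R u) ** (refl u ** refl c)"
        unfolding refl_mult[OF T] inv ..
      also have "\<dots> \<in> zariski_hull S"
        by (intro zariski_hull_mult[OF S] r(3) Z assms(5))
      finally show ?thesis using st(4) pos st(5) r(2) unfolding q[of r] X_def by blast
    qed
    have "0 \<in> X" using k c assms(5) by (simp add: X_def)
    \<comment> \<open>a finite nonempty set of reals has a largest element\<close>
    then have inf: "infinite X" using step by (metis Max_ge Max_in empty_iff not_le)
    show ?thesis
    proof (cases "a = 0")
      case True
      then have "b \<noteq> 0" using w by auto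
      then have "refl (a *\<^sub>R c - b *\<^sub>R u) = refl u" using True refl_scaleR[of "- b" u] by simp
      then show ?thesis using Z by simp
    next
      case False
      have e: "a *\<^sub>R c - b *\<^sub>R u = a *\<^sub>R (c + (- (b / a)) *\<^sub>R u)"
        using False by (simp add: algebra_simps)
      have "X \<subseteq> uminus ` {x. - x \<in> X}"
      proof
        fix x assume "x \<in> X"
        then show "x \<in> uminus ` {x. - x \<in> X}" by (intro image_eqI[of _ _ "- x"]) auto
      qed
      then have "infinite {x. - x \<in> X}" using inf finite_imageI finite_subset by metis
      moreover have "{x. - x \<in> X} \<subseteq> {x. mink (c + x *\<^sub>R u) (c + x *\<^sub>R u) > 0 \<and> refl (c + x *\<^sub>R u) \<in> zariski_hull S}"
        by (auto simp: X_def)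
      ultimately have "infinite {x. mink (c + x *\<^sub>R u) (c + x *\<^sub>R u) > 0 \<and> refl (c + x *\<^sub>R u) \<in> zariski_hull S}"
        using finite_subset by blast
      moreover have "mink (c + (- (b / a)) *\<^sub>R u) (c + (- (b / a)) *\<^sub>R u) > 0"
      proof -
        have "a\<^sup>2 * mink (c + (- (b / a)) *\<^sub>R u) (c + (- (b / a)) *\<^sub>R u) > 0"
          using w unfolding e by (simp only: mink_scaleR power2_eq_square mult.assoc)
        moreover have "a\<^sup>2 > 0" using False by simp
        ultimately show ?thesis by (rule zero_less_mult_pos)
      qed
      ultimately have "refl (c + (- (b / a)) *\<^sub>R u) \<in> zariski_hull S"
        by (rule refl_line_in_hull[of c u S "- (b / a)"])
      then show ?thesis unfolding e refl_scaleR[OF False] .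
    qed
  qed
  obtain a b where ab: "w = a *\<^sub>R c + b *\<^sub>R u"
    using w(1) by (auto simp: span_breakdown_eq) (metis add.commute diff_eq_eq)
  show ?thesis
  proof (cases "mink c u > 1")
    case True
    then show ?thesis using main[OF u, of a "- b"] Z w(2) ab by simp
  next
    case False
    then have "mink c (- u) > 1" using k by (simp add: mink_minus)
    then show ?thesis using main[of "- u" a b] u Z w(2) ab by (simp add: mink_minus refl_minus)
  qed
qed

lemma continuous_on_mink [continuous_intros]:
  assumes "continuous_on A f" "continuous_on A g"
  shows "continuous_on A (\<lambda>x. mink (f x) (g x) :: real)"
  unfolding mink_def using assms by (intro continuous_intros)

text \<open>
  Timelike and isotropic vectors of \<open>U\<close> are normal to no hyperplane of hyperbolic space and are exempt.
\<close>

definition refls_in_hull :: "('n::finite) mink_matrix set \<Rightarrow> 'n minkowski set \<Rightarrow> bool" where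
  "refls_in_hull S U \<longleftrightarrow> (\<forall>u\<in>U. mink u u > 0 \<longrightarrow> refl u \<in> zariski_hull S)"

text \<open>
  A subspace of mixed signature contains isotropic vectors not orthogonal to \<open>c\<close>; spacelike vectors
  close to such a vector are short, while their product with \<open>c\<close> stays away from \<open>0\<close>. The proof makes
  this explicit on a line \<open>t + x *\<^sub>R s\<close>.
\<close>

lemma exists_spacelike_far:
  fixes c :: "('n::finite) minkowski"
  assumes U: "subspace U" and t: "t \<in> U" "mink t t < 0" and s: "s \<in> U" "mink s s > 0"
    and u: "u \<in> U" "mink u c \<noteq> 0"
  obtains v where "v \<in> U" "mink v v > 0" "(mink v c)\<^sup>2 > mink v v"
proof -
  have "\<exists>t\<in>U. mink t t < 0 \<and> mink t c \<noteq> 0"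
  proof (cases "mink t c = 0")
    case True
    have "open {x :: real. mink (t + x *\<^sub>R u) (t + x *\<^sub>R u) < 0}"
      by (intro open_Collect_less continuous_intros)
    then have "infinite {x :: real. mink (t + x *\<^sub>R u) (t + x *\<^sub>R u) < 0}"
      using t by (intro open_nonempty_infinite[of _ 0]) auto
    then obtain x where "mink (t + x *\<^sub>R u) (t + x *\<^sub>R u) < 0" "x \<noteq> 0"
      by (metis (mono_tags, lifting) finite.emptyI finite_insert finite_subset insertI1 mem_Collect_eq subsetI)
    moreover have "mink (t + x *\<^sub>R u) c \<noteq> 0" using True u \<open>x \<noteq> 0\<close> by (simp add: mink_bilinear)
    moreover have "t + x *\<^sub>R u \<in> U" using U t u by (simp add: subspace_add subspace_scale)
    ultimately show ?thesis by blast
  qed (use t in blast)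
  then obtain t where t: "t \<in> U" "mink t t < 0" "mink t c \<noteq> 0" by blast
  define A where "A = mink t t"
  define B where "B = mink t s"
  define C where "C = mink s s"
  define l where "l = mink t c"
  define m where "m = mink s c"
  \<comment> \<open>the points where the form takes the small value \<open>d\<close> lie on both sides of \<open>t\<close>, and the product with \<open>c\<close> cannot shrink on both sides\<close>
  define d where "d = l\<^sup>2 / 2"
  \<comment> \<open>the discriminant of \<open>A + 2 * B * x + C * x\<^sup>2 = d\<close>\<close>
  define D where "D = sqrt (B\<^sup>2 - C * (A - d))"
  have AC: "A < 0" "C > 0" using t s by (auto simp: A_def C_def)
  have d: "d > 0" "d < l\<^sup>2" using t by (auto simp: d_def l_def)
  have "C * (A - d) < 0" using AC d by (intro mult_pos_neg) auto
  then have pos: "B\<^sup>2 - C * (A - d) > B\<^sup>2" by linarith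
  then have "B\<^sup>2 - C * (A - d) \<ge> 0" using zero_le_power2[of B] by linarith
  then have D2: "D\<^sup>2 = B\<^sup>2 - C * (A - d)" and "D \<ge> 0" unfolding D_def by simp_all
  moreover have "\<bar>B\<bar>\<^sup>2 < D\<^sup>2" using D2 pos by simp
  ultimately have D: "D > \<bar>B\<bar>" using power2_less_imp_less by blast
  have q: "mink (t + x *\<^sub>R s) (t + x *\<^sub>R s) = A + 2 * B * x + C * x\<^sup>2" for x
    by (simp add: mink_bilinear A_def B_def C_def mink_commute[of s t] power2_eq_square algebra_simps)
  have lin: "mink (t + x *\<^sub>R s) c = l + m * x" for x
    by (simp add: mink_bilinear l_def m_def)
  define x where "x = (D - B) / C"
  define y where "y = (D + B) / C"
  have xy: "x > 0" "y > 0" using D AC by (auto simp: x_def y_def)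
  have Cx: "C * x = D - B" "C * y = D + B" using AC by (auto simp: x_def y_def)
  have "C * (A + 2 * B * x + C * x\<^sup>2 - d) = 0" "C * (A - 2 * B * y + C * y\<^sup>2 - d) = 0"
    using D2 Cx by algebra+
  then have qx: "mink (t + x *\<^sub>R s) (t + x *\<^sub>R s) = d" and qy: "mink (t + (- y) *\<^sub>R s) (t + (- y) *\<^sub>R s) = d"
    using AC unfolding q by auto
  have "(l + m * x)\<^sup>2 > d \<or> (l + m * (- y))\<^sup>2 > d"
  proof (cases "l * m \<ge> 0")
    case True
    have "(l + m * x)\<^sup>2 = l\<^sup>2 + 2 * (l * m) * x + (m * x)\<^sup>2" by algebra
    then show ?thesis using True xy d by (smt (verit) mult_nonneg_nonneg zero_le_power2)
  next
    case False
    have "(l + m * (- y))\<^sup>2 = l\<^sup>2 + 2 * (- (l * m)) * y + (m * y)\<^sup>2" by algebra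
    then show ?thesis using False xy d by (smt (verit) mult_nonneg_nonneg zero_le_power2)
  qed
  moreover have "t + z *\<^sub>R s \<in> U" for z using U t s by (simp add: subspace_add subspace_scale)
  ultimately show thesis using that qx qy lin d by metis
qed

text \<open>
  For \<open>v\<close> in a nonempty open part of \<open>U\<close> the mirrors of \<open>v\<close> and \<open>c\<close> are ultraparallel, so the plane
  spanned by \<open>v\<close> and \<open>c\<close> is available. These planes fill an open part of the new subspace, and
  polynomial equations extend from there along lines.
\<close>

lemma refls_in_hull_insert:
  fixes c :: "('n::finite) minkowski"
  assumes S: "\<And>A B. A \<in> S \<Longrightarrow> B \<in> S \<Longrightarrow> A ** B \<in> S"
    and U: "subspace U" "refls_in_hull S U"
    and t: "t \<in> U" "mink t t < 0" and s: "s \<in> U" "mink s s > 0"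
    and u: "u \<in> U" "mink u c \<noteq> 0" and c: "mink c c = 1" "refl c \<in> zariski_hull S"
  shows "refls_in_hull S (span (insert c U))"
  unfolding refls_in_hull_def
proof (intro ballI impI)
  fix w assume "w \<in> span (insert c U)" and w: "mink w w > 0"
  then obtain k where "w - k *\<^sub>R c \<in> U" 
    using span_eq_iff[THEN iffD2, OF U(1)] by (auto simp: span_breakdown_eq)
  moreover define v where "v = w - k *\<^sub>R c"
  ultimately have v: "v \<in> U" "w = v + k *\<^sub>R c" by auto
  obtain u0 where u0: "u0 \<in> U" "mink u0 u0 > 0" "(mink u0 c)\<^sup>2 > mink u0 u0"
    using exists_spacelike_far[OF U(1) t s u] .
  \<comment> \<open>move from \<open>u0\<close> to \<open>w\<close> along \<open>g\<close>; for small \<open>x\<close> the point \<open>g x\<close> lies in the plane of \<open>c\<close> and \<open>f x\<close>, and these are ultraparallel\<close>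
  define f where "f x = u0 + x *\<^sub>R (v - u0)" for x :: real
  define g where "g x = u0 + x *\<^sub>R (w - u0)" for x :: real
  have fU: "f x \<in> U" for x
    using U(1) v(1) u0(1) by (simp add: f_def subspace_add subspace_scale subspace_diff)
  have gf: "g x = f x + (x * k) *\<^sub>R c" for x by (simp add: f_def g_def v(2) algebra_simps)
  define X where "X = {x. mink (f x) (f x) > 0} \<inter> {x. (mink (f x) c)\<^sup>2 > mink (f x) (f x)} \<inter> {x. mink (g x) (g x) > 0}"
  have "open X" unfolding X_def f_def g_def
    by (intro open_Int open_Collect_less continuous_intros)
  moreover have "0 \<in> X" using u0 by (simp add: X_def f_def g_def)
  ultimately have "infinite X" by (rule open_nonempty_infinite)
  moreover have "refl (g x) \<in> zariski_hull S" if "x \<in> X" for x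
  proof -
    have x: "mink (f x) (f x) > 0" "(mink (f x) c)\<^sup>2 > mink (f x) (f x)" "mink (g x) (g x) > 0"
      using that by (auto simp: X_def)
    define n where "n = sqrt (mink (f x) (f x))"
    have n: "n > 0" "n\<^sup>2 = mink (f x) (f x)" using x by (auto simp: n_def)
    define e where "e = (1 / n) *\<^sub>R f x"
    have fe: "f x = n *\<^sub>R e" using n by (simp add: e_def)
    have e1: "mink e e = 1" using n x(1) by (simp add: e_def mink_scaleR power2_eq_square)
    have "(mink (f x) c)\<^sup>2 = n\<^sup>2 * (mink e c)\<^sup>2" by (simp add: fe mink_scaleR power_mult_distrib)
    then have "mink (f x) (f x) * 1 < mink (f x) (f x) * (mink e c)\<^sup>2" using x(2) n by simp
    then have "(mink e c)\<^sup>2 > 1" using x(1) by (simp only: mult_less_cancel_left_pos)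
    then have ec: "\<bar>mink c e\<bar> > 1" by (simp add: mink_commute[of e c] abs_square_le_1 flip: not_le)
    have "refl e \<in> zariski_hull S"
      using U(2) fU[of x] x(1) n refl_scaleR[of "1 / n" "f x"] unfolding refls_in_hull_def e_def by auto
    moreover have "g x \<in> span {c, e}"
      unfolding gf fe by (intro span_add span_scale span_base) auto
    ultimately show ?thesis
      using ultraparallel_plane_in_hull[OF S c(1) e1 ec c(2)] x(3) by blast
  qed
  moreover have "mink (g x) (g x) > 0" if "x \<in> X" for x using that by (simp add: X_def)
  ultimately have "infinite {x. mink (g x) (g x) > 0 \<and> refl (g x) \<in> zariski_hull S}"
    by (metis (mono_tags, lifting) finite_subset mem_Collect_eq subsetI)
  then have "refl (u0 + 1 *\<^sub>R (w - u0)) \<in> zariski_hull S"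
    unfolding g_def by (rule refl_line_in_hull) (use w in simp)
  then show "refl w \<in> zariski_hull S" by simp
qed

section \<open>Generation of the isometry group by reflections\<close>

lemma refl_swap:
  assumes "mink x x = mink y y" "mink (x - y) (x - y) \<noteq> 0"
  shows "refl (x - y) *v x = y"
proof -
  have "mink (x - y) (x - y) = 2 * mink x (x - y)"
    using assms(1) by (simp add: mink_bilinear mink_commute[of y x])
  then show ?thesis using assms(2) by (simp add: refl_apply)
qed

text \<open>
  The Cartan-Dieudonne argument: compose with reflections until the base point and the coordinate axes
  are fixed one after the other. Once the base point is fixed, each axis differs from its image by a vector in the
  tangent space, which is spacelike unless it vanishes.
\<close>

lemma Isom_subset_hull:
  assumes S: "\<And>A B. A \<in> S \<Longrightarrow> B \<in> S \<Longrightarrow> A ** B \<in> S" "mat 1 \<in> S"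
    and R: "refls_in_hull S (UNIV :: ('n::finite) minkowski set)"
  shows "carrier Isom \<subseteq> zariski_hull S"
proof
  fix A :: "'n mink_matrix" assume A: "A \<in> carrier Isom"
  define p :: "'n minkowski" where "p = axis None 1"
  have p: "p \<in> hyperboloid" by (simp add: p_def hyperboloid_def mink_def axis_def)
  have R: "refl v \<in> zariski_hull S" if "mink v v > 0" for v :: "'n minkowski"
    using R that by (simp add: refls_in_hull_def)
  have id: "mat 1 \<in> zariski_hull S" using S(2) zariski_hull_incl by blast
  have ex: "\<exists>B C. A = B ** C \<and> B \<in> zariski_hull S \<and> C \<in> carrier Isom \<and> C *v p = p \<and>
      (\<forall>i\<in>T. C *v axis (Some i) 1 = axis (Some i) 1)" if "finite T" for T
    using that
  proof (induction T)
    case empty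
    define v where "v = A *v p - p"
    show ?case
    proof (cases "v = 0")
      case True
      then show ?thesis using A id by (intro exI[of _ "mat 1"] exI[of _ A]) (simp add: v_def)
    next
      case False
      have Ap: "A *v p \<in> hyperboloid" using A p by (rule Isom_hyperboloid)
      have q: "mink v v = -2 - 2 * mink (A *v p) p"
        using hyperboloidD(1)[OF p] hyperboloidD(1)[OF Ap]
        by (simp add: v_def mink_bilinear mink_commute[of p "A *v p"])
      have "mink (A *v p) p \<noteq> -1"
      proof
        assume "mink (A *v p) p = -1"
        then have "mink v p = 0" "mink v v = 0" using q hyperboloidD(1)[OF p] by (simp_all add: v_def mink_bilinear)
        then show False using orthogonal_timelike(2)[OF p] False by blast
      qed
      then have pos: "mink v v > 0" using q mink_hyperboloid_le[OF Ap p] by simp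
      have "refl v *v (A *v p) = p"
        unfolding v_def using pos IsomD[OF A] by (intro refl_swap) (auto simp: v_def)
      moreover have "A = refl v ** (refl v ** A)" using pos by (simp add: matrix_mul_assoc refl_refl)
      moreover have "refl v ** A \<in> carrier Isom" using Isom.m_closed[OF refl_in_Isom[OF pos] A] by simp
      ultimately show ?thesis
        using R[OF pos] by (intro exI[of _ "refl v"] exI[of _ "refl v ** A"]) (simp add: matrix_vector_mul_assoc)
    qed
  next
    case (insert i T)
    then obtain B C where BC: "A = B ** C" "B \<in> zariski_hull S" and C: "C \<in> carrier Isom" "C *v p = p"
      "\<forall>i\<in>T. C *v axis (Some i) 1 = axis (Some i) 1" by blast
    define e where "e = (axis (Some i) 1 :: 'n minkowski)"
    define v where "v = C *v e - e"
    show ?case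
    proof (cases "v = 0")
      case True
      then show ?thesis using BC C by (intro exI[of _ B] exI[of _ C]) (simp add: v_def e_def)
    next
      case False
      have orth: "mink v x = 0" if "C *v x = x" "mink e x = 0" for x
        using IsomD[OF C(1), of e x] that by (simp add: v_def mink_bilinear)
      have fix_v: "refl v *v x = x" if "C *v x = x" "mink e x = 0" for x
        using orth[OF that] by (simp add: refl_apply mink_commute[of x v])
      have ep: "mink e p = 0" by (simp add: e_def p_def mink_def axis_def)
      then have "mink v p = 0" by (intro orth C(2))
      then have pos: "mink v v > 0"
        using orthogonal_timelike[OF p, of v] False by (metis less_eq_real_def)
      have "refl v *v (C *v e) = e"
        unfolding v_def using pos IsomD[OF C(1)] by (intro refl_swap) (auto simp: v_def)
      moreover have "mink e (axis (Some j) 1) = 0" if "j \<in> T" for j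
      proof -
        have "j \<noteq> i" using that insert.hyps by blast
        then show ?thesis by (auto simp: e_def mink_def axis_def intro!: sum.neutral)
      qed
      moreover have "A = (B ** refl v) ** (refl v ** C)"
      proof -
        have "(B ** refl v) ** (refl v ** C) = B ** (refl v ** refl v) ** C" by (simp add: matrix_mul_assoc)
        then show ?thesis using pos BC(1) by (simp add: refl_refl)
      qed
      moreover have "refl v ** C \<in> carrier Isom" using Isom.m_closed[OF refl_in_Isom[OF pos] C(1)] by simp
      moreover have "B ** refl v \<in> zariski_hull S" using zariski_hull_mult[OF S(1) BC(2) R[OF pos]] .
      ultimately show ?thesis using C fix_v[OF C(2) ep]
        by (intro exI[of _ "B ** refl v"] exI[of _ "refl v ** C"])
          (auto simp: e_def[symmetric] fix_v simp flip: matrix_vector_mul_assoc)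
    qed
  qed
  obtain B C where BC: "A = B ** C" "B \<in> zariski_hull S" "C *v p = p"
      "\<forall>i\<in>UNIV. C *v axis (Some i) 1 = axis (Some i) 1" using ex[of UNIV] by auto
  have "C *v axis k 1 = axis k 1" for k using BC(3,4) by (cases k) (auto simp: p_def)
  then have "column k C = column k (mat 1)" for k
    unfolding matrix_vector_mult_basis[symmetric] by simp
  then have "C $ i $ k = mat 1 $ i $ k" for i k
    by (simp add: column_def vec_eq_iff)
  then have "C = mat 1" by (simp add: vec_eq_iff)
  then show "A \<in> zariski_hull S" using BC by simp
qed

section \<open>Orbits of roots under Zariski dense groups\<close>

text \<open>
  Every unit spacelike vector is, up to sign, the image of \<open>e\<close> under a single reflection. Evenness is
  what makes \<open>A \<mapsto> g (A *v e)\<close> a regular function.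
\<close>

lemma even_polynomial_vanishing_on_orbit:
  fixes G :: "('n::finite) mink_matrix set"
  assumes G: "zariski_dense G" and e: "mink e e = 1"
    and g: "real_polynomial_function g" "\<And>x. g (- x) = g x" and 0: "\<And>A. A \<in> G \<Longrightarrow> g (A *v e) = 0"
    and w: "mink w w = 1"
  shows "g w = 0"
proof -
  have all: "g (A *v e) = 0" if "A \<in> carrier Isom" for A
  proof -
    have lin: "linear (\<lambda>A :: 'n mink_matrix. A *v e)"
      by (auto intro!: linearI simp: matrix_vector_mult_def vec_eq_iff sum.distrib algebra_simps sum_distrib_left)
    then have "real_polynomial_function (g \<circ> (\<lambda>A :: 'n mink_matrix. A *v e))"
      using g(1) by (intro real_polynomial_function_compose polynomial_function_bounded_linear)
        (simp_all add: linear_conv_bounded_linear)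
    moreover have "(- A) *v e = - (A *v e)" for A :: "'n mink_matrix"
      using linear_neg[OF lin] by simp
    ultimately have "PO_regular (\<lambda>A. g (A *v e))" using g(2) by (simp add: PO_regular_def o_def)
    moreover have "A \<in> zariski_hull G" using G that by (auto simp: zariski_dense_iff)
    ultimately show ?thesis using zariski_hullD 0 by blast
  qed
  have *: "g x = 0" if x: "mink x x = 1" "mink e x < 1" for x
  proof -
    have "mink (e - x) (e - x) = 2 * (1 - mink e x)"
      using x e by (simp add: mink_bilinear mink_commute[of x e])
    then have pos: "mink (e - x) (e - x) > 0" using x(2) by simp
    then have "refl (e - x) *v e = x" using e x(1) by (intro refl_swap) auto
    then show ?thesis using all[OF refl_in_Isom[OF pos]] by simp
  qed
  show ?thesis
  proof (cases "mink e w < 1")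
    case True
    then show ?thesis using * w by simp
  next
    case False
    then show ?thesis using *[of "- w"] w g(2) by (simp add: mink_minus)
  qed
qed

text \<open>
  Apply the previous lemma to the quadratic form \<open>mink l x * mink m x\<close>. With \<open>l = m\<close> this shows that the
  orbit spans; in general it replaces irreducibility.
\<close>

lemma orbit_not_orthogonal:
  fixes G :: "('n::finite) mink_matrix set"
  assumes G: "zariski_dense G" and e: "mink e e = 1" and l: "l \<noteq> 0" and m: "m \<noteq> 0"
  obtains A where "A \<in> G" "mink l (A *v e) \<noteq> 0" "mink m (A *v e) \<noteq> 0"
proof (rule ccontr)
  assume no: "\<not> thesis"
  note witness = that
  have 0: "mink l (A *v e) * mink m (A *v e) = 0" if "A \<in> G" for A
    using witness[OF that] no by auto
  define g where "g x = mink l x * mink m x" for x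
  have g: "real_polynomial_function g"
    unfolding g_def by (intro real_polynomial_function.intros bounded_linear_mink_right)
  have unit: "g w = 0" if "mink w w = 1" for w
    using even_polynomial_vanishing_on_orbit[OF G e g _ _ that] 0 by (simp add: g_def mink_minus)
  have spacelike: "g w = 0" if w: "mink w w > 0" for w
  proof -
    have "g ((1 / sqrt (mink w w)) *\<^sub>R w) = 0"
      by (rule unit) (use w in \<open>simp add: mink_scaleR\<close>)
    then show ?thesis using w by (simp add: g_def mink_scaleR)
  qed
  have all: "g y = 0" for y
  proof -
    have "open {x :: real. mink (e + x *\<^sub>R (y - e)) (e + x *\<^sub>R (y - e)) > 0}"
      by (intro open_Collect_less continuous_intros)
    then have "infinite {x :: real. mink (e + x *\<^sub>R (y - e)) (e + x *\<^sub>R (y - e)) > 0}"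
      using e by (intro open_nonempty_infinite[of _ 0]) auto
    then have "infinite {x :: real. g (e + x *\<^sub>R (y - e)) = 0}"
      using spacelike by (metis (mono_tags, lifting) finite_subset mem_Collect_eq subsetI)
    then have "g (e + 1 *\<^sub>R (y - e)) = 0" by (rule polynomial_on_line_eq_0[OF g])
    then show ?thesis by simp
  qed
  let ?l = "time_flip l" and ?m = "time_flip m"
  have ll: "mink l ?l > 0" "mink m ?m > 0" using l m by (simp_all add: mink_inner)
  have lm: "mink m ?l = mink l ?m" by (simp add: mink_inner inner_commute)
  have "mink l ?m = 0" using all[of ?l] ll lm by (simp add: g_def)
  then have "mink l (?l + ?m) * mink m (?l + ?m) > 0"
    using ll lm by (simp add: mink_bilinear)
  then show False using all[of "?l + ?m"] unfolding g_def by linarith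
qed

text \<open>
  A finite set closed under negation is the zero set of an even polynomial, whereas there are infinitely
  many unit spacelike vectors.
\<close>

lemma orbit_infinite:
  fixes G :: "('n::finite) mink_matrix set"
  assumes G: "zariski_dense G" and e: "mink e e = 1"
  shows "infinite ((\<lambda>A. A *v e) ` G)" (is "infinite ?E")
proof
  assume fin: "finite ?E"
  \<comment> \<open>an even polynomial that vanishes exactly on the orbit and its negative\<close>
  define g where "g x = (\<Prod>f\<in>?E. ((x - f) \<bullet> (x - f)) * ((x + f) \<bullet> (x + f)))" for x
  have coord: "real_polynomial_function (\<lambda>x :: 'n minkowski. x $ k)" for k
    using bounded_linear_vec_nth by blast
  have "real_polynomial_function (\<lambda>x. (x - f) \<bullet> (x - f))" "real_polynomial_function (\<lambda>x. (x + f) \<bullet> (x + f))"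
    for f :: "'n minkowski"
    unfolding inner_vec_def inner_real_def vector_minus_component vector_add_component
    by (intro real_polynomial_function_sum real_polynomial_function.intros(4) real_polynomial_function_diff
        real_polynomial_function.intros(3) coord real_polynomial_function.intros(2); simp)+
  then have g: "real_polynomial_function g"
    unfolding g_def by (intro real_polynomial_function_prod fin real_polynomial_function.intros(4))
  have "g (- x) = g x" for x
    unfolding g_def
  proof (rule prod.cong[OF HOL.refl])
    fix f
    have "- x - f = - (x + f)" "- x + f = - (x - f)" by simp_all
    then show "(- x - f) \<bullet> (- x - f) * ((- x + f) \<bullet> (- x + f)) = (x - f) \<bullet> (x - f) * ((x + f) \<bullet> (x + f))"
      by (simp only: inner_minus_left inner_minus_right) simp
  qed
  moreover have "g (A *v e) = 0" if "A \<in> G" for A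
    unfolding g_def using that fin by (intro prod_zero) (auto intro!: bexI[of _ A])
  ultimately have zero: "g w = 0" if "mink w w = 1" for w
    using even_polynomial_vanishing_on_orbit[OF G e g _ _ that] by blast
  have "w \<in> ?E \<union> uminus ` ?E" if w: "mink w w = 1" for w
  proof -
    obtain f where f: "f \<in> ?E" "((w - f) \<bullet> (w - f)) * ((w + f) \<bullet> (w + f)) = 0"
      using zero[OF w] unfolding g_def prod_zero_iff[OF fin] by (rule bexE)
    then have "w = f \<or> w = - f" by (simp add: eq_neg_iff_add_eq_0)
    then show ?thesis using f(1) by blast
  qed
  then have "{w :: 'n minkowski. mink w w = 1} \<subseteq> ?E \<union> uminus ` ?E" by (intro subsetI) simp
  then have "finite {w :: 'n minkowski. mink w w = 1}"
    by (rule finite_subset) (intro finite_UnI finite_imageI fin)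
  moreover have "infinite {w :: 'n minkowski. mink w w = 1}"
  proof -
    define h where "h x = sqrt (1 + x\<^sup>2) *\<^sub>R axis (Some undefined) 1 + x *\<^sub>R (axis None 1 :: 'n minkowski)" for x :: real
    have "h x $ None = x" for x by (simp add: h_def axis_def)
    then have inj: "inj h" by (metis injI)
    have "mink (h x) (h x) = 1" for x
      by (simp add: h_def mink_bilinear mink_axis time_flip_def) (simp add: axis_def flip: power2_eq_square)
    then have "range h \<subseteq> {w. mink w w = 1}" by blast
    moreover have "infinite (range h)"
      using finite_imageD[OF _ inj] infinite_UNIV_char_0[where 'a = real] by blast
    ultimately show ?thesis using infinite_super by blast
  qed
  ultimately show False by blast
qed

text \<open>
  Otherwise all products of roots in the orbit are bounded by \<open>1\<close>; since the orbit spans, its elements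
  have bounded coordinates, and discreteness leaves only finitely many of them.
\<close>

lemma exists_ultraparallel_root:
  fixes G :: "('n::finite) mink_matrix set"
  assumes G: "zariski_dense G" "discrete_subgroup G" and e: "e \<in> roots G"
  obtains A where "A \<in> G" "\<bar>mink e (A *v e)\<bar> > 1"
proof (rule ccontr)
  assume no: "\<not> thesis"
  note witness = that
  have le: "\<bar>mink e (A *v e)\<bar> \<le> 1" if "A \<in> G" for A
    using witness[OF that] no by force
  have S: "subgroup G Isom" using G(2) by (simp add: discrete_subgroup_def)
  let ?E = "(\<lambda>A. A *v e) ` G"
  have le2: "\<bar>mink x y\<bar> \<le> 1" if xy: "x \<in> ?E" "y \<in> ?E" for x y
  proof -
    obtain A B where AB: "A \<in> G" "x = A *v e" "B \<in> G" "y = B *v e" using xy by blast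
    have A: "A \<in> carrier Isom" and C: "inv\<^bsub>Isom\<^esub> A ** B \<in> G" using AB subgroup_closed[OF S] by auto
    have "mink x y = mink e (inv\<^bsub>Isom\<^esub> A *v (B *v e))"
      using mink_inv[OF A, of "B *v e" e] by (simp add: AB mink_commute)
    then show ?thesis using le[OF C] by (simp add: matrix_vector_mul_assoc)
  qed
  have span: "span ?E = UNIV"
  proof (rule ccontr)
    assume "span ?E \<noteq> UNIV"
    then obtain a where a: "a \<noteq> 0" "\<forall>x\<in>span ?E. a \<bullet> x = 0" using span_not_UNIV_orthogonal by metis
    have "time_flip a \<noteq> 0" using a by simp
    then obtain A where "A \<in> G" "mink (time_flip a) (A *v e) \<noteq> 0"
      using orbit_not_orthogonal[OF G(1) rootsD(1)[OF e]] by metis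
    then show False using a(2) by (auto simp: time_flip_inner[symmetric] intro: span_base)
  qed
  have bound: "\<exists>C. \<forall>x\<in>?E. \<bar>mink x y\<bar> \<le> C" if "y \<in> span ?E" for y
    using that
  proof (induction rule: span_induct_alt)
    case base
    show ?case by (rule exI[of _ 0]) simp
  next
    case (step c y z)
    then obtain C where C: "\<forall>x\<in>?E. \<bar>mink x z\<bar> \<le> C" by blast
    have "\<bar>mink x (c *\<^sub>R y + z)\<bar> \<le> \<bar>c\<bar> + C" if "x \<in> ?E" for x
    proof -
      have "\<bar>mink x (c *\<^sub>R y + z)\<bar> \<le> \<bar>c\<bar> * \<bar>mink x y\<bar> + \<bar>mink x z\<bar>"
        by (simp add: mink_bilinear) (metis abs_mult abs_triangle_ineq)
      also have "\<dots> \<le> \<bar>c\<bar> * 1 + C"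
        using le2[OF that step(1)] C that by (intro add_mono mult_left_mono) auto
      finally show ?thesis by simp
    qed
    then show ?case by blast
  qed
  have "\<exists>C. \<forall>x\<in>?E. \<bar>x $ k\<bar> \<le> C" for k
  proof -
    obtain C where C: "\<forall>x\<in>?E. \<bar>mink x (time_flip (axis k 1))\<bar> \<le> C" using bound span by blast
    have "mink x (time_flip (axis k 1)) = x $ k" for x :: "'n minkowski"
      using time_flip_inner[of "axis k 1" x] by (simp add: mink_commute inner_axis')
    then show ?thesis using C by auto
  qed
  then obtain C where C: "\<And>k x. x \<in> ?E \<Longrightarrow> \<bar>x $ k\<bar> \<le> C k" by metis
  have "norm x \<le> (\<Sum>k\<in>UNIV. C k)" if "x \<in> ?E" for x
    using norm_le_l1_cart[of x] sum_mono[of UNIV "\<lambda>k. \<bar>x $ k\<bar>" C] C[OF that] by fastforce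
  moreover have "?E \<subseteq> roots G" using roots_mult[OF S _ e] by blast
  ultimately have "?E \<subseteq> {x \<in> roots G. norm x \<le> (\<Sum>k\<in>UNIV. C k)}" by blast
  then have "finite ?E" using finite_roots_norm[OF G(2)] finite_subset by blast
  then show False using orbit_infinite[OF G(1) rootsD(1)[OF e]] by blast
qed

section \<open>Finitely many reflections suffice\<close>

lemma generate_closed:
  "A \<in> generate Isom S \<Longrightarrow> B \<in> generate Isom S \<Longrightarrow> A ** B \<in> generate Isom S"
  "mat 1 \<in> generate Isom S"
  using generate.eng[of A Isom S B] generate.one[of Isom S] by simp_all

text \<open>
  Among all pairs of a finite set of roots and a Lorentzian subspace whose reflections lie in the
  Zariski closure, one with subspace of maximal dimension is considered; the subspace must be
  everything.
\<close>

lemma finite_roots_zariski_dense: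
  fixes G :: "('n::finite) mink_matrix set"
  assumes G: "zariski_dense G" "discrete_subgroup G" and e: "e \<in> roots G"
  obtains F where "finite F" "F \<subseteq> roots G" "zariski_dense (generate Isom (refl ` F))"
proof -
  have S: "subgroup G Isom" using G(2) by (simp add: discrete_subgroup_def)
  define P where "P F U \<longleftrightarrow> finite F \<and> F \<subseteq> roots G \<and> subspace U \<and> refls_in_hull (generate Isom (refl ` F)) U \<and>
    (\<exists>t\<in>U. mink t t < 0) \<and> (\<exists>s\<in>U. mink s s > 0)" for F U
  have gen: "refl c \<in> zariski_hull (generate Isom (refl ` F))" if "c \<in> F" for c F
    using that generate.incl[of "refl c" "refl ` F" Isom] zariski_hull_incl by blast
  \<comment> \<open>an ultraparallel pair of roots starts the construction\<close>
  have "\<exists>F U. P F U"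
  proof -
    obtain A where A: "A \<in> G" "\<bar>mink e (A *v e)\<bar> > 1" using exists_ultraparallel_root[OF G e] .
    define f where "f = A *v e"
    have f: "f \<in> roots G" "mink f f = 1" using roots_mult[OF S A(1) e] by (auto simp: f_def roots_def)
    have e1: "mink e e = 1" using e by (rule rootsD)
    have k: "\<bar>mink e f\<bar> > 1" using A by (simp add: f_def)
    have "refls_in_hull (generate Isom (refl ` {e, f})) (span {e, f})"
      unfolding refls_in_hull_def
      by (intro ballI impI, rule ultraparallel_plane_in_hull[OF generate_closed(1) e1 f(2) k gen gen]) auto
    moreover have "mink (f - mink e f *\<^sub>R e) (f - mink e f *\<^sub>R e) < 0"
    proof -
      have "mink (f - mink e f *\<^sub>R e) (f - mink e f *\<^sub>R e) = 1 - (mink e f)\<^sup>2"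
        by (simp add: mink_bilinear e1 f(2) mink_commute[of f e] power2_eq_square)
      then show ?thesis using k abs_square_le_1[of "mink e f"] by simp
    qed
    moreover have "f - mink e f *\<^sub>R e \<in> span {e, f}" "e \<in> span {e, f}"
      by (intro span_diff span_scale span_base; simp)+
    ultimately have "P {e, f} (span {e, f})"
      unfolding P_def using e f(1) e1 by (metis (no_types, lifting) empty_subsetI finite.emptyI finite.insertI insert_subset subspace_span zero_less_one)
    then show ?thesis by blast
  qed
  then obtain F0 U0 where "P F0 U0" by blast
  then have "\<exists>x. (\<exists>F U. P F U \<and> dim U = x)" by blast
  moreover have "x \<le> DIM('n minkowski)" if "\<exists>F U. P F U \<and> dim U = x" for x
    using that dim_subset_UNIV by metis
  ultimately obtain x where x: "\<exists>F U. P F U \<and> dim U = x"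
    "\<And>y. \<exists>F U. P F U \<and> dim U = y \<Longrightarrow> y \<le> x"
    using Greatest_le_nat[of "\<lambda>x. \<exists>F U. P F U \<and> dim U = x" _ "DIM('n minkowski)"]
      GreatestI_nat[of "\<lambda>x. \<exists>F U. P F U \<and> dim U = x" _ "DIM('n minkowski)"] by blast
  then obtain F U where FU: "P F U" "\<And>F' U'. P F' U' \<Longrightarrow> dim U' \<le> dim U" by metis
  have F: "finite F" "F \<subseteq> roots G" and U: "subspace U" "refls_in_hull (generate Isom (refl ` F)) U"
    using FU(1) by (auto simp: P_def)
  obtain t s where t: "t \<in> U" "mink t t < 0" and s: "s \<in> U" "mink s s > 0" using FU(1) by (auto simp: P_def)
  have "U = UNIV"
  proof (rule ccontr)
    assume "U \<noteq> UNIV"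
    then have "span U \<noteq> UNIV" using U(1) span_eq_iff by blast
    then obtain a where a: "a \<noteq> 0" "\<forall>x\<in>span U. a \<bullet> x = 0" using span_not_UNIV_orthogonal by metis
    have "time_flip a \<noteq> 0" "t \<noteq> 0" using a t by auto
    then obtain A where A: "A \<in> G" "mink (time_flip a) (A *v e) \<noteq> 0" "mink t (A *v e) \<noteq> 0"
      using orbit_not_orthogonal[OF G(1) rootsD(1)[OF e]] by metis
    define c where "c = A *v e"
    have c: "c \<in> roots G" using roots_mult[OF S A(1) e] by (simp add: c_def)
    have cU: "c \<notin> span U" using a(2) A(2) by (auto simp: c_def time_flip_inner)
    let ?S = "generate Isom (refl ` insert c F)"
    have "generate Isom (refl ` F) \<subseteq> ?S" by (intro Isom.mono_generate) blast
    then have U': "refls_in_hull ?S U"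
      using U(2) zariski_hull_mono unfolding refls_in_hull_def by blast
    have "refls_in_hull ?S (span (insert c U))"
      using A(3) by (intro refls_in_hull_insert[OF generate_closed(1) U(1) U' t s t(1) _ rootsD(1)[OF c] gen])
        (auto simp: c_def)
    moreover have "U \<subseteq> span (insert c U)" using span_superset[of "insert c U"] by blast
    ultimately have "P (insert c F) (span (insert c U))"
      unfolding P_def using F c t s by (intro conjI subspace_span bexI[of _ t] bexI[of _ s]) auto
    then have "dim (span (insert c U)) \<le> dim U" by (rule FU(2))
    then show False using cU by (simp add: dim_insert)
  qed
  then have "carrier Isom \<subseteq> zariski_hull (generate Isom (refl ` F))"
    using U(2) by (intro Isom_subset_hull generate_closed) auto
  moreover have "refl ` F \<subseteq> carrier Isom" using F(2) subgroup_closed(3)[OF S] by (auto simp: roots_def)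
  then have "generate Isom (refl ` F) \<subseteq> carrier Isom" by (rule Isom.generate_incl)
  ultimately show thesis using that F by (simp add: zariski_dense_iff)
qed

section \<open>Words in reflections\<close>

definition word :: "('n::finite) minkowski list \<Rightarrow> 'n mink_matrix" where
  "word as = foldr (\<lambda>a A. refl a ** A) as (mat 1)"

lemma word_simps [simp]: "word [] = mat 1" "word (a # as) = refl a ** word as"
  by (simp_all add: word_def)

lemma word_append: "word (as @ bs) = word as ** word bs"
  by (induction as) (simp_all add: matrix_mul_assoc)

abbreviation refl_group :: "('n::finite) minkowski set \<Rightarrow> 'n mink_matrix set" where
  "refl_group I \<equiv> generate Isom (refl ` I)"

lemma word_in_refl_group: "set as \<subseteq> I \<Longrightarrow> word as \<in> refl_group I"
  by (induction as) (auto intro: generate_closed generate.incl)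

lemma refl_groupE:
  fixes I :: "('n::finite) minkowski set"
  assumes I: "\<And>e. e \<in> I \<Longrightarrow> mink e e = 1" and A: "A \<in> refl_group I"
  obtains as where "set as \<subseteq> I" "A = word as"
proof -
  have "\<exists>as. set as \<subseteq> I \<and> A = word as"
    using A
  proof (induction rule: generate.induct)
    case one
    show ?case by (rule exI[of _ "[]"]) simp
  next
    case (incl h)
    then obtain e where "e \<in> I" "h = refl e" by blast
    then show ?case by (intro exI[of _ "[e]"]) simp
  next
    case (inv h)
    then obtain e where e: "e \<in> I" "h = refl e" by blast
    then have "inv\<^bsub>Isom\<^esub> h = word [e]" using I by (simp add: Isom_inv_refl)
    then show ?case using e(1) by (intro exI[of _ "[e]"]) simp
  next
    case (eng g h)
    then obtain as bs where "set as \<subseteq> I" "g = word as" "set bs \<subseteq> I" "h = word bs" by blast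
    then show ?case by (intro exI[of _ "as @ bs"]) (simp add: word_append)
  qed
  then show thesis using that by blast
qed

lemma refl_group_subset:
  assumes "subgroup H Isom" "refl ` I \<subseteq> H"
  shows "refl_group I \<subseteq> H"
  using Isom.generate_subgroup_incl[OF assms(2,1)] .

lemma refl_group_subgroup:
  assumes "I \<subseteq> roots G" "subgroup G Isom"
  shows "subgroup (refl_group I) Isom"
  using assms subgroup_closed(3) by (intro Isom.generate_is_subgroup) (auto simp: roots_def)

lemma discrete_subgroup_subset:
  assumes "discrete_subgroup G" "subgroup H Isom" "H \<subseteq> G"
  shows "discrete_subgroup H"
  using assms islimpt_subset unfolding discrete_subgroup_def discrete_def isolated_in_islimpt_iff by blast

section \<open>Positive and simple roots\<close>

text \<open>
  The positive roots are those pointing to the side of the base point; a positive root changes sign under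
  an isometry when its mirror separates the base point from its preimage.
\<close>

locale chamber =
  fixes \<Gamma> :: "('n::finite) mink_matrix set" and p :: "'n minkowski"
  assumes discrete: "discrete_subgroup \<Gamma>" and base: "p \<in> hyperboloid"
    and generic: "\<And>e. e \<in> roots \<Gamma> \<Longrightarrow> mink p e \<noteq> 0"
begin

lemma subgroup: "subgroup \<Gamma> Isom"
  using discrete by (simp add: discrete_subgroup_def)

definition positive :: "'n minkowski set" where
  "positive = {e \<in> roots \<Gamma>. mink p e > 0}"

text \<open>
  The walls of the chamber of \<open>p\<close>, described without geometry: a simple reflection changes the sign of no
  other positive root.
\<close>

definition simple :: "'n minkowski set" where
  "simple = {a \<in> positive. \<forall>e\<in>positive. e \<noteq> a \<longrightarrow> refl a *v e \<in> positive}"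

lemma positiveD: "e \<in> positive \<Longrightarrow> e \<in> roots \<Gamma>" "e \<in> positive \<Longrightarrow> mink p e > 0"
    "e \<in> positive \<Longrightarrow> mink e e = 1" "e \<in> positive \<Longrightarrow> refl e \<in> \<Gamma>"
  by (auto simp: positive_def roots_def)

lemma simpleD: "a \<in> simple \<Longrightarrow> a \<in> positive"
    "a \<in> simple \<Longrightarrow> e \<in> positive \<Longrightarrow> e \<noteq> a \<Longrightarrow> refl a *v e \<in> positive"
  by (auto simp: simple_def)

lemma simple_unit: "a \<in> simple \<Longrightarrow> mink a a = 1"
  using simpleD(1) positiveD(3) by blast

lemma positive_or_negative: "e \<in> roots \<Gamma> \<Longrightarrow> e \<in> positive \<or> - e \<in> positive"
  using generic[of e] by (auto simp: positive_def roots_minus mink_minus)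

lemma not_positive_minus: "e \<in> positive \<Longrightarrow> - e \<notin> positive"
  by (simp add: positive_def mink_minus)

lemma roots_mult': "A \<in> \<Gamma> \<Longrightarrow> e \<in> roots \<Gamma> \<Longrightarrow> A *v e \<in> roots \<Gamma>"
  by (rule roots_mult[OF subgroup])

lemma finite_positive_le: "finite {e \<in> positive. mink p e \<le> C}"
  by (rule finite_subset[OF _ finite_roots_bounded[OF discrete base, of C]]) (auto simp: positive_def)

lemma height_bounded_below: "\<exists>h>0. \<forall>e\<in>positive. mink p e \<ge> h"
proof -
  let ?X = "insert 1 (mink p ` {e \<in> positive. mink p e \<le> 1})"
  have fin: "finite ?X" using finite_positive_le by simp
  have "Min ?X > 0" using fin positiveD(2) by (subst Min_gr_iff) auto
  moreover have "mink p e \<ge> Min ?X" if "e \<in> positive" for e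
  proof (cases "mink p e \<le> 1")
    case True
    then show ?thesis using that fin by (intro Min_le) auto
  next
    case False
    then show ?thesis using Min_le[OF fin, of 1] by simp
  qed
  ultimately show ?thesis by blast
qed

lemma refl_group_in: "I \<subseteq> simple \<Longrightarrow> refl_group I \<subseteq> \<Gamma>"
  using simpleD(1) positiveD(4) by (intro refl_group_subset[OF subgroup]) blast

lemma subgroup_refl_group: "I \<subseteq> simple \<Longrightarrow> subgroup (refl_group I) Isom"
  using simpleD(1) positiveD(1) by (intro refl_group_subgroup[OF _ subgroup]) blast

lemma simple_word:
  assumes "I \<subseteq> simple" "A \<in> refl_group I"
  obtains as where "set as \<subseteq> I" "A = word as"
  using refl_groupE[OF _ assms(2)] simple_unit assms(1) by blast

lemma word_in: "set as \<subseteq> simple \<Longrightarrow> word as \<in> \<Gamma>"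
  using word_in_refl_group refl_group_in by blast

text \<open>
  If the angle were acute, the composition of the two reflections would send the positive root
  \<open>b\<close> to a negative one by way of the positive root \<open>refl a *v b\<close>, although only \<open>b\<close> itself
  may change sign under \<open>refl b\<close>.
\<close>

lemma simple_obtuse:
  assumes a: "a \<in> simple" and b: "b \<in> simple" and ne: "a \<noteq> b"
  shows "mink a b \<le> 0"
proof (rule ccontr)
  define c where "c = mink a b"
  assume "\<not> mink a b \<le> 0"
  then have c: "c > 0" by (simp add: c_def)
  have ra: "refl a *v b = b - (2 * c) *\<^sub>R a"
    by (simp add: refl_unit simple_unit[OF a] c_def mink_commute[of b a])
  have rb: "refl b *v a = a - (2 * c) *\<^sub>R b"
    by (simp add: refl_unit simple_unit[OF b] c_def)
  have pos: "refl a *v b \<in> positive" "refl b *v a \<in> positive"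
    using a b ne simpleD by blast+
  have "refl a *v b \<noteq> b"
    using ra c simple_unit[OF a] by auto
  then have "refl b *v (refl a *v b) \<in> positive" using simpleD(2)[OF b pos(1)] by blast
  moreover have "refl b *v (refl a *v b) = - b - (2 * c) *\<^sub>R (refl b *v a)"
    unfolding ra matrix_vector_mult_diff_distrib matrix_vector_mult_scaleR
    by (simp add: refl_self simple_unit[OF b])
  ultimately have "- mink p b - 2 * c * mink p (refl b *v a) > 0"
    using positiveD(2) by (fastforce simp: mink_bilinear)
  moreover have "mink p b > 0" "2 * c * mink p (refl b *v a) > 0"
    using positiveD(2)[OF pos(2)] positiveD(2)[OF simpleD(1)[OF b]] c by auto
  ultimately show False by linarith
qed

lemma sign_change:
  assumes bs: "set bs \<subseteq> simple" and a: "a \<in> positive" and neg: "word bs *v a \<notin> positive"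
  shows "\<exists>xs b ys. bs = xs @ b # ys \<and> word ys *v a = b"
  using bs neg
proof (induction bs)
  case Nil
  then show ?case using a by simp
next
  case (Cons b ys)
  show ?case
  proof (cases "word ys *v a \<in> positive")
    case True
    then have "word ys *v a = b"
      using simpleD(2)[of b "word ys *v a"] Cons.prems by (auto simp: matrix_vector_mul_assoc)
    then show ?thesis by blast
  next
    case False
    then obtain xs c zs where "ys = xs @ c # zs" "word zs *v a = c" using Cons by auto
    then show ?thesis by (metis append_Cons)
  qed
qed

text \<open>
  The deletion condition of Coxeter groups: the letter at which \<open>a\<close> changes sign is conjugate to \<open>refl a\<close>
  by the part of the word to its right, and cancels with it.
\<close>

lemma deletion:
  assumes bs: "set bs \<subseteq> simple" and a: "a \<in> simple" and neg: "word bs *v a \<notin> positive"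
  shows "\<exists>cs. set cs \<subseteq> set bs \<and> length cs < length bs \<and> word (bs @ [a]) = word cs"
proof -
  obtain xs b ys where d: "bs = xs @ b # ys" "word ys *v a = b"
    using sign_change[OF bs simpleD(1)[OF a] neg] by blast
  have "word ys \<in> carrier Isom"
    using d(1) bs word_in subgroup_closed(3)[OF subgroup] by auto
  then have "refl b ** word ys = word ys ** refl a" using refl_conj[of "word ys" a] d(2) by simp
  then have "refl b ** word ys ** refl a = word ys ** (refl a ** refl a)" by (simp add: matrix_mul_assoc)
  then have "word (bs @ [a]) = word (xs @ ys)"
    using simple_unit[OF a] by (simp add: d(1) word_append refl_refl) (metis matrix_mul_assoc)
  then show ?thesis using d(1) by (intro exI[of _ "xs @ ys"]) auto
qed

text \<open>
  In a word of minimal length, the word before the last letter maps the root of that letter to a positive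
  root, so every letter contributes a nonnegative multiple of a positive height.
\<close>

lemma antidominant_height_increases:
  assumes I: "I \<subseteq> simple" and y: "\<And>a. a \<in> I \<Longrightarrow> mink y a \<le> 0" and u: "u \<in> refl_group I"
  shows "mink p y \<le> mink p (u *v y)"
proof -
  have "set bs \<subseteq> I \<Longrightarrow> mink p y \<le> mink p (word bs *v y)" for bs
  proof (induction bs rule: length_induct)
    case (1 bs)
    show ?case
    proof (cases bs rule: rev_cases)
      case (snoc cs a)
      have cs: "set cs \<subseteq> I" "a \<in> I" using 1(2) snoc by auto
      show ?thesis
      proof (cases "word cs *v a \<in> positive")
        case True
        have "word bs *v y = word cs *v (refl a *v y)"
          by (simp add: snoc word_append matrix_vector_mul_assoc)
        also have "\<dots> = word cs *v y - (2 * mink y a) *\<^sub>R (word cs *v a)"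
          using simple_unit[of a] I cs(2)
          by (auto simp: refl_unit matrix_vector_mult_diff_distrib matrix_vector_mult_scaleR)
        finally have "mink p (word bs *v y) = mink p (word cs *v y) + 2 * (- mink y a) * mink p (word cs *v a)"
          by (simp add: mink_bilinear)
        moreover have "2 * (- mink y a) * mink p (word cs *v a) \<ge> 0"
          using y[OF cs(2)] positiveD(2)[OF True] by (intro mult_nonneg_nonneg) auto
        moreover have "mink p y \<le> mink p (word cs *v y)" using 1(1) cs snoc by simp
        ultimately show ?thesis by linarith
      next
        case False
        then obtain ds where "set ds \<subseteq> set cs" "length ds < length cs" "word bs = word ds"
          using deletion[of cs a] cs I snoc by auto
        then have "set ds \<subseteq> I" "length ds < length bs" using cs snoc by auto
        then have "mink p y \<le> mink p (word ds *v y)" using 1(1) by blast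
        then show ?thesis using \<open>word bs = word ds\<close> by simp
      qed
    qed simp
  qed
  moreover obtain bs where "set bs \<subseteq> I" "u = word bs" using simple_word[OF I u] .
  ultimately show ?thesis by blast
qed

text \<open>
  In dual form: positive roots of the subgroup generated by \<open>I\<close> are nonnegative combinations of
  the elements of \<open>I\<close>. Apply the height estimate to \<open>refl e\<close>.
\<close>

lemma antidominant_positive:
  assumes I: "I \<subseteq> simple" and y: "\<And>a. a \<in> I \<Longrightarrow> mink y a \<le> 0"
    and e: "e \<in> positive" "refl e \<in> refl_group I"
  shows "mink y e \<le> 0"
proof -
  have "mink p y \<le> mink p (y - (2 * mink y e) *\<^sub>R e)"
    using antidominant_height_increases[OF I y e(2)] positiveD(3)[OF e(1)] by (simp add: refl_unit)
  then have "mink y e * mink p e \<le> 0" by (simp add: mink_bilinear mult.commute)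
  then show ?thesis using positiveD(2)[OF e(1)] by (simp add: mult_le_0_iff)
qed

text \<open>
  Take \<open>y = s\<close> in the previous lemma, which is admissible because distinct simple roots are obtuse.
\<close>

lemma simple_refl_notin:
  assumes I: "I \<subseteq> simple" and s: "s \<in> simple" "s \<notin> I"
  shows "refl s \<notin> refl_group I"
proof
  assume *: "refl s \<in> refl_group I"
  have "mink s a \<le> 0" if "a \<in> I" for a
  proof -
    have "a \<in> simple" "s \<noteq> a" using that I s(2) by auto
    then show ?thesis using simple_obtuse[OF s(1)] by blast
  qed
  then have "mink s s \<le> 0" using antidominant_positive[OF I _ simpleD(1)[OF s(1)] *] by blast
  then show False using simple_unit[OF s(1)] by simp
qed

text \<open>
  A letter \<open>a\<close> of \<open>I\<close> changes the sign of no positive root but \<open>a\<close>, whose reflection lies in the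
  subgroup.
\<close>

lemma positive_outside_preserved:
  assumes I: "I \<subseteq> simple" and u: "u \<in> refl_group I" and e: "e \<in> positive" "refl e \<notin> refl_group I"
  shows "u *v e \<in> positive"
proof -
  have "word as *v e \<in> positive \<and> refl (word as *v e) \<notin> refl_group I" if "set as \<subseteq> I" for as
    using that
  proof (induction as)
    case Nil
    then show ?case using e by simp
  next
    case (Cons a as)
    define f where "f = word as *v e"
    have f: "f \<in> positive" "refl f \<notin> refl_group I" using Cons by (auto simp: f_def)
    have a: "a \<in> simple" "refl a \<in> refl_group I" using Cons.prems I by (auto intro: generate.incl)
    have "refl a *v f \<in> positive" using f a by (intro simpleD(2)) auto
    moreover have "refl (refl a *v f) \<notin> refl_group I"
    proof
      assume *: "refl (refl a *v f) \<in> refl_group I"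
      have "refl (refl a *v f) ** refl a = refl a ** refl f"
        by (rule refl_conj) (use a simple_unit in \<open>simp add: refl_in_Isom\<close>)
      then have "refl a ** (refl (refl a *v f) ** refl a) = (refl a ** refl a) ** refl f"
        by (simp add: matrix_mul_assoc)
      then have "refl f = refl a ** (refl (refl a *v f) ** refl a)"
        using a simple_unit by (simp add: refl_refl)
      then show False using f(2) a(2) * generate_closed(1) by metis
    qed
    ultimately show ?case by (simp add: f_def matrix_vector_mul_assoc)
  qed
  moreover obtain as where "set as \<subseteq> I" "u = word as" using simple_word[OF I u] .
  ultimately show ?thesis by blast
qed

end

section \<open>Simple roots generate\<close>

text \<open>
  Geometrically: the hypothesis on \<open>mink p f\<close> says that the foot of the perpendicular from \<open>p\<close> to the
  mirror of \<open>e\<close> is not on the same side of the mirror of \<open>f\<close> as \<open>p\<close>. So the latter mirror is closer to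
  \<open>p\<close>, and so is the image of the mirror of \<open>e\<close> under \<open>refl f\<close>; the second inequality expresses this
  because the height of that image is \<open>mink p e - 2 * mink e f * mink p f\<close>.
\<close>

lemma separating_mirror_lower:
  assumes p: "p \<in> hyperboloid" and e: "mink e e = 1" "mink p e > 0" and f: "mink f f = 1" "mink p f > 0"
    and c: "mink e f > 0" and near: "mink p f \<le> mink e f * mink p e" and ne: "e \<noteq> f"
  shows "mink p f < mink p e" "mink e f * mink p f < mink p e"
proof -
  define c h k where "c = mink e f" and "h = mink p e" and "k = mink p f"
  have pos: "c > 0" "h > 0" "k > 0" "k \<le> c * h" using assms by (simp_all add: c_def h_def k_def)
  have pp: "mink p p = -1" using hyperboloidD(1)[OF p] .
  have psd: "mink (x + mink p x *\<^sub>R p) (x + mink p x *\<^sub>R p) \<ge> 0" for x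
    using orthogonal_timelike[OF p, of "x + mink p x *\<^sub>R p"] pp by (simp_all add: mink_bilinear mink_commute[of x p])
  have q: "mink (x + mink p x *\<^sub>R p) (x + mink p x *\<^sub>R p) = mink x x + (mink p x)\<^sup>2" for x
    using pp by (simp add: mink_bilinear mink_commute[of x p] power2_eq_square)
  have less: "c * k < h"
  proof (cases "c < 1")
    case True
    have "c * k < 1 * k" using True pos by (intro mult_strict_right_mono) auto
    also have "k \<le> c * h" using pos by simp
    also have "\<dots> < 1 * h" using True pos by (intro mult_strict_right_mono) auto
    finally show ?thesis by simp
  next
    case False
    show ?thesis
    proof (cases "c = 1")
      case True
      have "mink (e - f) (e - f) = 0" using e f True by (simp add: mink_bilinear mink_commute[of f e] c_def)
      moreover have "k \<noteq> h"
      proof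
        assume "k = h"
        then have "mink p (e - f) = 0" by (simp add: mink_bilinear h_def k_def)
        then show False using orthogonal_timelike(2)[OF p, of "e - f"] \<open>mink (e - f) (e - f) = 0\<close> ne
          by (simp add: mink_commute)
      qed
      ultimately show ?thesis using True pos by simp
    next
      case c1: False
      then have c1: "c > 1" using False by simp
      define s where "s = c + h * k"
      \<comment> \<open>Cauchy-Schwarz for the projections of \<open>e\<close> and \<open>f\<close> to the tangent space at \<open>p\<close>,
        whose inner product is \<open>s\<close> and whose squared lengths are \<open>1 + h\<^sup>2\<close> and \<open>1 + k\<^sup>2\<close>\<close>
      have CS: "s\<^sup>2 \<le> (1 + h\<^sup>2) * (1 + k\<^sup>2)"
      proof -
        let ?x = "(1 + h\<^sup>2) *\<^sub>R f - s *\<^sub>R e"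
        have "mink ?x ?x + (mink p ?x)\<^sup>2 \<ge> 0" using psd[of ?x] q[of ?x] by simp
        moreover have "mink ?x ?x + (mink p ?x)\<^sup>2 = (1 + h\<^sup>2) * ((1 + h\<^sup>2) * (1 + k\<^sup>2) - s\<^sup>2)"
          by (simp add: mink_bilinear e f mink_commute[of f e] c_def[symmetric] h_def[symmetric] k_def[symmetric] s_def
              power2_eq_square algebra_simps)
        moreover have "1 + h\<^sup>2 > 0" by (simp add: add_pos_nonneg)
        ultimately show ?thesis by (simp add: zero_le_mult_iff)
      qed
      have sq: "(c * h - k)\<^sup>2 \<ge> (c\<^sup>2 - 1) * (1 + h\<^sup>2)"
        using CS by (simp add: s_def power2_eq_square algebra_simps)
      show ?thesis
      proof (rule ccontr)
        assume "\<not> c * k < h"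
        then have "h \<le> c * k" by simp
        then have "c * (c * h - k) \<le> (c\<^sup>2 - 1) * h" by (simp add: power2_eq_square algebra_simps)
        moreover have "0 \<le> c * (c * h - k)" using pos by simp
        ultimately have "(c * (c * h - k))\<^sup>2 \<le> ((c\<^sup>2 - 1) * h)\<^sup>2" by (intro power_mono) auto
        then have "c\<^sup>2 * (c * h - k)\<^sup>2 \<le> (c\<^sup>2 - 1)\<^sup>2 * h\<^sup>2" by (simp add: power_mult_distrib)
        moreover have "c\<^sup>2 * ((c\<^sup>2 - 1) * (1 + h\<^sup>2)) \<le> c\<^sup>2 * (c * h - k)\<^sup>2"
          using sq by (intro mult_left_mono) auto
        ultimately have "(c\<^sup>2 - 1) * (c\<^sup>2 * (1 + h\<^sup>2)) \<le> (c\<^sup>2 - 1) * ((c\<^sup>2 - 1) * h\<^sup>2)"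
          by (simp add: power2_eq_square algebra_simps)
        moreover have "c\<^sup>2 - 1 > 0" using c1 by simp
        ultimately have "c\<^sup>2 * (1 + h\<^sup>2) \<le> (c\<^sup>2 - 1) * h\<^sup>2" by (simp only: mult_le_cancel_left_pos)
        then have "c\<^sup>2 + h\<^sup>2 \<le> 0" by (simp add: algebra_simps)
        then show False using pos by (smt (verit) zero_less_power)
      qed
    qed
  qed
  then show "mink e f * mink p f < mink p e" by (simp add: c_def h_def k_def)
  have "k < h"
  proof (cases "c < 1")
    case True
    have "c * h < 1 * h" using True pos by (intro mult_strict_right_mono) auto
    then show ?thesis using pos by linarith
  next
    case False
    then have "1 * k \<le> c * k" using pos by (intro mult_right_mono) auto
    then show ?thesis using less by simp
  qed
  then show "mink p f < mink p e" by (simp add: h_def k_def)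
qed

context chamber
begin

text \<open>
  Induction on the height, of which only finitely many values occur below a given one. If \<open>e\<close> is not
  simple, \<open>refl e\<close> is conjugate to a reflection of smaller height by another one of smaller height.
\<close>

lemma refl_in_simple_group:
  assumes "e \<in> positive"
  shows "refl e \<in> refl_group simple"
  using assms
proof (induction "card {f \<in> positive. mink p f < mink p e}" arbitrary: e rule: less_induct)
  case less
  have fin: "finite {f \<in> positive. mink p f < C}" for C
    by (rule finite_subset[OF _ finite_positive_le[of C]]) auto
  have IH: "refl f \<in> refl_group simple" if f: "f \<in> positive" "mink p f < mink p e" for f
  proof (rule less.hyps[OF _ f(1)])
    show "card {g \<in> positive. mink p g < mink p f} < card {g \<in> positive. mink p g < mink p e}"
      using f by (intro psubset_card_mono fin) (auto intro!: psubsetI)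
  qed
  have e: "mink e e = 1" "mink p e > 0" "e \<in> roots \<Gamma>" "refl e \<in> \<Gamma>" using less.prems positiveD by auto
  show ?case
  proof (cases "e \<in> simple")
    case True
    then show ?thesis by (intro generate.incl) blast
  next
    case False
    then obtain f where f: "f \<in> positive" "f \<noteq> e" "refl e *v f \<notin> positive"
      using less.prems by (auto simp: simple_def)
    define c where "c = mink e f"
    \<comment> \<open>the mirror of \<open>f\<close> separates \<open>p\<close> from its mirror image in \<open>e\<close>, and so does that of \<open>f'\<close>\<close>
    define f' where "f' = (2 * c) *\<^sub>R e - f"
    have "refl e *v f = - f'"
      using e(1) by (simp add: refl_unit f'_def c_def mink_commute[of f e])
    moreover have "refl e *v f \<in> roots \<Gamma>" using roots_mult'[OF e(4)] positiveD(1)[OF f(1)] .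
    ultimately have f': "f' \<in> positive" using positive_or_negative f(3) by fastforce
    have ef': "mink e f' = c" using e(1) by (simp add: f'_def mink_bilinear c_def)
    have sum: "mink p f + mink p f' = 2 * c * mink p e" by (simp add: f'_def mink_bilinear)
    then have "2 * c * mink p e > 0" using positiveD(2)[OF f(1)] positiveD(2)[OF f'] by simp
    then have c: "c > 0" using e(2) by (simp add: zero_less_mult_iff)
    have "f' \<noteq> e"
    proof
      assume "f' = e"
      then have "f = (2 * c - 1) *\<^sub>R e" by (simp add: f'_def algebra_simps)
      moreover have "c = 1" using ef' \<open>f' = e\<close> e(1) by simp
      ultimately show False using f(2) by simp
    qed
    \<comment> \<open>of the two mirrors exchanged by the reflection, at least one is met before the mirror of \<open>e\<close>\<close>
    then obtain g where g: "g \<in> positive" "g \<noteq> e" "mink e g = c" "mink p g \<le> c * mink p e"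
      using f f' ef' sum c_def by (cases "mink p f \<le> c * mink p e") (auto simp: c_def)
    have gu: "mink g g = 1" "mink p g > 0" using g(1) positiveD by auto
    have lower: "mink p g < mink p e" "c * mink p g < mink p e"
      using separating_mirror_lower[OF base e(1,2) gu] c g by auto
    define r where "r = refl g *v e"
    have r: "r \<in> roots \<Gamma>" unfolding r_def using roots_mult'[OF positiveD(4)[OF g(1)] e(3)] .
    have pr: "mink p r = mink p e - 2 * c * mink p g"
      using gu(1) g(3) by (simp add: r_def refl_unit mink_bilinear)
    have "2 * c * mink p g > 0" using c gu by simp
    then have "refl r \<in> refl_group simple"
      using positive_or_negative[OF r] IH[of r] IH[of "- r"] pr lower
      by (auto simp: mink_minus refl_minus)
    moreover have rg: "refl g \<in> refl_group simple" using IH g(1) lower(1) by blast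
    moreover have "refl r ** refl g = refl g ** refl e"
      unfolding r_def using gu(1) by (intro refl_conj refl_in_Isom) simp
    then have "refl g ** (refl r ** refl g) = (refl g ** refl g) ** refl e" by (simp add: matrix_mul_assoc)
    then have "refl e = refl g ** (refl r ** refl g)" using gu(1) by (simp add: refl_refl)
    ultimately show ?thesis using generate_closed(1) by metis
  qed
qed

lemma refl_root_in_simple_group:
  assumes "e \<in> roots \<Gamma>"
  shows "refl e \<in> refl_group simple"
  using positive_or_negative[OF assms] refl_in_simple_group[of e] refl_in_simple_group[of "- e"]
  by (auto simp: refl_minus)

lemma dominant_nonneg:
  assumes "\<And>a. a \<in> simple \<Longrightarrow> mink x a \<ge> 0" and "e \<in> positive"
  shows "mink x e \<ge> 0"
  using antidominant_positive[of simple "- x" e] assms refl_in_simple_group by (simp add: mink_minus)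

lemma max_reflection_subgroup_eq: "max_reflection_subgroup \<Gamma> = refl_group simple"
proof
  have "{r \<in> \<Gamma>. is_reflection r} \<subseteq> refl_group simple"
    using refl_root_in_simple_group by (auto simp: is_reflection_iff roots_def)
  then show "max_reflection_subgroup \<Gamma> \<subseteq> refl_group simple"
    unfolding max_reflection_subgroup_def
    by (rule Isom.generate_subgroup_incl) (rule subgroup_refl_group, simp)
  show "refl_group simple \<subseteq> max_reflection_subgroup \<Gamma>"
    unfolding max_reflection_subgroup_def
    using positiveD simpleD(1) simple_unit by (intro Isom.mono_generate) (auto simp: is_reflection_refl)
qed

lemma root_preimage: "A \<in> \<Gamma> \<Longrightarrow> e \<in> roots \<Gamma> \<Longrightarrow> inv\<^bsub>Isom\<^esub> A *v e \<in> roots \<Gamma>"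
  using roots_mult' subgroup_closed(4)[OF subgroup] by blast

text \<open>
  Reflecting in a simple root that is negative on the image of \<open>p\<close> brings this image closer to \<open>p\<close>,
  as measured by \<open>- mink\<close>. The gain is bounded below by twice the square of the least height, so the process ends.
\<close>

lemma move_to_chamber:
  assumes "A \<in> \<Gamma>"
  obtains u where "u \<in> refl_group simple" "\<And>e. e \<in> positive \<Longrightarrow> mink (u ** A *v p) e > 0"
proof -
  obtain h where h: "h > 0" "\<And>e. e \<in> positive \<Longrightarrow> mink p e \<ge> h"
    using height_bounded_below by blast
  have shifted: "mink (A *v p) e = mink p (inv\<^bsub>Isom\<^esub> A *v e)" "inv\<^bsub>Isom\<^esub> A *v e \<in> roots \<Gamma>"
    if "A \<in> \<Gamma>" "e \<in> positive" for A e
    using mink_inv[of A e p] that root_preimage positiveD subgroup_closed(3)[OF subgroup]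
    by (auto simp: mink_commute)
  have "\<exists>u\<in>refl_group simple. \<forall>e\<in>positive. mink (u ** A *v p) e > 0"
    if "A \<in> \<Gamma>" "- mink p (A *v p) \<le> of_nat n * (2 * h\<^sup>2)" for n A
    using that
  proof (induction n arbitrary: A)
    case 0
    have "A *v p \<in> hyperboloid" using 0(1) Isom_hyperboloid base subgroup_closed(3)[OF subgroup] by blast
    then show ?case using mink_hyperboloid_le[OF base, of "A *v p"] 0 by simp
  next
    case (Suc n)
    show ?case
    proof (cases "\<forall>a\<in>simple. mink (A *v p) a \<ge> 0")
      case True
      have "mink (A *v p) e > 0" if "e \<in> positive" for e
      proof -
        have "mink (A *v p) e \<ge> 0" using dominant_nonneg True that by blast
        moreover have "mink (A *v p) e \<noteq> 0" using shifted[OF Suc(2) that] generic by metis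
        ultimately show ?thesis by simp
      qed
      then show ?thesis using generate_closed(2) by (intro bexI[of _ "mat 1"]) auto
    next
      case False
      then obtain a where a: "a \<in> simple" "mink (A *v p) a < 0" by force
      have au: "mink a a = 1" "refl a \<in> \<Gamma>" "a \<in> positive" using a simple_unit simpleD(1) positiveD(4) by auto
      define e where "e = inv\<^bsub>Isom\<^esub> A *v a"
      have e: "mink (A *v p) a = mink p e" "e \<in> roots \<Gamma>" using shifted[OF Suc(2) au(3)] by (auto simp: e_def)
      then have "- e \<in> positive" using positive_or_negative a(2) positiveD(2) by fastforce
      then have he: "- mink p e \<ge> h" using h(2)[of "- e"] by (simp add: mink_minus)
      have "refl a ** A *v p = A *v p - (2 * mink (A *v p) a) *\<^sub>R a"
        using au(1) by (simp add: refl_unit flip: matrix_vector_mul_assoc)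
      then have "- mink p (refl a ** A *v p) = - mink p (A *v p) - 2 * ((- mink p e) * mink p a)"
        by (simp add: mink_bilinear e(1))
      moreover have "(- mink p e) * mink p a \<ge> h * h"
        using he h au(3) by (intro mult_mono) (auto simp: less_imp_le)
      ultimately have "- mink p (refl a ** A *v p) \<le> of_nat n * (2 * h\<^sup>2)"
        using Suc.prems(2) by (simp add: power2_eq_square algebra_simps)
      moreover have "refl a ** A \<in> \<Gamma>" using au(2) Suc(2) subgroup_closed(1)[OF subgroup] by blast
      ultimately obtain u where u: "u \<in> refl_group simple" "\<forall>e\<in>positive. mink (u ** (refl a ** A) *v p) e > 0"
        using Suc.IH by blast
      moreover have "u ** refl a \<in> refl_group simple"
        by (intro generate_closed(1) generate.incl imageI u(1) a(1))
      ultimately show ?thesis by (metis matrix_mul_assoc)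
    qed
  qed
  note reach = this
  have "2 * h\<^sup>2 > 0" using h(1) by simp
  then obtain n where "- mink p (A *v p) < of_nat n * (2 * h\<^sup>2)"
    using ex_less_of_nat_mult[of "2 * h\<^sup>2" "- mink p (A *v p)"] by blast
  then have "\<exists>u\<in>refl_group simple. \<forall>e\<in>positive. mink (u ** A *v p) e > 0"
    by (intro reach[OF assms] less_imp_le)
  then show thesis using that by blast
qed

section \<open>Finitely many simple roots give finite index\<close>

lemma rcosets_eq: "rcosets\<^bsub>Isom\<lparr>carrier := K\<rparr>\<^esub> H = (\<lambda>g. (\<lambda>h. h ** g) ` H) ` K"
  by (auto simp: RCOSETS_def r_coset_def)

lemma right_coset_eq:
  assumes H: "subgroup H Isom" and u: "u \<in> H"
  shows "(\<lambda>h. h ** (u ** g)) ` H = (\<lambda>h. h ** g) ` H"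
proof -
  have "H = (\<lambda>h. h ** u) ` H"
  proof
    show "H \<subseteq> (\<lambda>h. h ** u) ` H"
    proof
      fix h assume h: "h \<in> H"
      have "h = h ** inv\<^bsub>Isom\<^esub> u ** u"
        using Isom_inv(1)[OF subgroup_closed(3)[OF H u]] by (simp flip: matrix_mul_assoc)
      then show "h \<in> (\<lambda>h. h ** u) ` H"
        using subgroup_closed(1)[OF H h subgroup_closed(4)[OF H u]] by blast
    qed
  qed (use subgroup_closed(1)[OF H _ u] in blast)
  then have "(\<lambda>h. h ** g) ` H = (\<lambda>h. h ** g) ` (\<lambda>h. h ** u) ` H" by metis
  then show ?thesis by (simp add: image_image matrix_mul_assoc)
qed

lemma positive_stabilizer_inv:
  assumes A: "A \<in> \<Gamma>" "\<And>e. e \<in> positive \<Longrightarrow> A *v e \<in> positive" and e: "e \<in> positive"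
  shows "inv\<^bsub>Isom\<^esub> A *v e \<in> positive"
proof (rule ccontr)
  assume "\<not> ?thesis"
  then have "- (inv\<^bsub>Isom\<^esub> A *v e) \<in> positive"
    using positive_or_negative root_preimage[OF A(1)] positiveD(1)[OF e] by blast
  then have "A *v (- (inv\<^bsub>Isom\<^esub> A *v e)) \<in> positive" by (rule A(2))
  moreover have "A *v (- (inv\<^bsub>Isom\<^esub> A *v e)) = - e"
    using Isom_inv_apply(2)[of A e] subgroup_closed(3)[OF subgroup A(1)] by (simp add: vec.neg)
  ultimately show False using not_positive_minus[OF e] by simp
qed

lemma positive_stabilizer_simple:
  assumes A: "A \<in> \<Gamma>" "\<And>e. e \<in> positive \<Longrightarrow> A *v e \<in> positive" and a: "a \<in> simple"
  shows "A *v a \<in> simple"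
proof -
  have AI: "A \<in> carrier Isom" using A(1) subgroup_closed(3)[OF subgroup] by blast
  have "refl (A *v a) *v e \<in> positive" if e: "e \<in> positive" "e \<noteq> A *v a" for e
  proof -
    have "inv\<^bsub>Isom\<^esub> A *v e \<noteq> a" using e(2) Isom_inv_apply(2)[OF AI, of e] by auto
    then have "refl a *v (inv\<^bsub>Isom\<^esub> A *v e) \<in> positive"
      using simpleD(2)[OF a] positive_stabilizer_inv[OF A e(1)] by blast
    then have "A *v (refl a *v (inv\<^bsub>Isom\<^esub> A *v e)) \<in> positive" by (rule A(2))
    then show ?thesis by (simp add: refl_mult[OF AI] flip: matrix_vector_mul_assoc)
  qed
  then show ?thesis using A(2) simpleD(1)[OF a] by (simp add: simple_def)
qed

text \<open>
  Every coset has a representative that preserves the positive roots. Such an isometry permutes the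
  simple roots and is determined by this permutation, because the simple roots span.
\<close>

lemma finite_index_if_finite_simple:
  assumes fin: "finite simple" and dense: "zariski_dense \<Gamma>" and e: "e \<in> roots \<Gamma>"
  shows "\<not> infinite_index (refl_group simple) \<Gamma>"
proof -
  \<comment> \<open>the stabilizer of the chamber of \<open>p\<close>\<close>
  define \<Delta> where "\<Delta> = {A \<in> \<Gamma>. \<forall>e\<in>positive. A *v e \<in> positive}"
  have \<Delta>I: "A \<in> carrier Isom" "A \<in> \<Gamma>" "\<And>e. e \<in> positive \<Longrightarrow> A *v e \<in> positive" if "A \<in> \<Delta>" for A
    using that subgroup_closed(3)[OF subgroup] by (auto simp: \<Delta>_def)
  have \<Delta>inv: "inv\<^bsub>Isom\<^esub> A \<in> \<Delta>" if "A \<in> \<Delta>" for A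
    using positive_stabilizer_inv[of A] \<Delta>I[OF that] subgroup_closed(4)[OF subgroup] by (auto simp: \<Delta>_def)
  have orth: "y = 0" if y: "\<And>a. a \<in> simple \<Longrightarrow> mink y a = 0" for y
  proof (rule ccontr)
    assume "y \<noteq> 0"
    then obtain A where A: "A \<in> \<Gamma>" "mink y (A *v e) \<noteq> 0"
      using orbit_not_orthogonal[OF dense rootsD(1)[OF e]] by metis
    have zero: "mink y f = 0" if "f \<in> positive" for f
      using dominant_nonneg[of y f] dominant_nonneg[of "- y" f] y that by (simp add: mink_minus)
    show False
      using zero[of "A *v e"] zero[of "- (A *v e)"] A positive_or_negative[OF roots_mult'[OF A(1) e]]
      by (auto simp: mink_minus)
  qed
  have "inj_on (\<lambda>A. restrict (\<lambda>a. A *v a) simple) \<Delta>"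
  proof (rule inj_onI)
    fix A B assume A: "A \<in> \<Delta>" and B: "B \<in> \<Delta>"
      and eq: "restrict (\<lambda>a. A *v a) simple = restrict (\<lambda>a. B *v a) simple"
    then have AB: "A *v a = B *v a" if "a \<in> simple" for a using that by (metis restrict_apply')
    have "A *v x - B *v x = 0" for x
    proof (rule orth)
      fix a assume a: "a \<in> simple"
      define b where "b = inv\<^bsub>Isom\<^esub> A *v a"
      have b: "b \<in> simple" unfolding b_def
        using positive_stabilizer_simple[OF _ _ a] \<Delta>I[OF \<Delta>inv[OF A]] by blast
      have "a = A *v b" using Isom_inv_apply(2)[OF \<Delta>I(1)[OF A]] by (simp add: b_def)
      then show "mink (A *v x - B *v x) a = 0"
        using IsomD[OF \<Delta>I(1)[OF A], of x b] IsomD[OF \<Delta>I(1)[OF B], of x b] AB[OF b] by (simp add: mink_diff)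
    qed
    then show "A = B" by (simp add: matrix_eq)
  qed
  moreover have "(\<lambda>A. restrict (\<lambda>a. A *v a) simple) ` \<Delta> \<subseteq> PiE simple (\<lambda>_. simple)"
    using positive_stabilizer_simple \<Delta>I by auto
  ultimately have fin\<Delta>: "finite \<Delta>" using finite_PiE[OF fin fin] inj_on_finite by blast
  have "rcosets\<^bsub>Isom\<lparr>carrier := \<Gamma>\<rparr>\<^esub> (refl_group simple) \<subseteq> (\<lambda>g. (\<lambda>h. h ** g) ` refl_group simple) ` \<Delta>"
    unfolding rcosets_eq
  proof (rule image_subsetI)
    fix A assume A: "A \<in> \<Gamma>"
    obtain u where u: "u \<in> refl_group simple" "\<And>e. e \<in> positive \<Longrightarrow> mink (u ** A *v p) e > 0"
      using move_to_chamber[OF A] by blast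
    have B: "u ** A \<in> \<Gamma>" using u(1) refl_group_in[of simple] A subgroup_closed(1)[OF subgroup] by blast
    then have BI: "u ** A \<in> carrier Isom" using subgroup_closed(3)[OF subgroup] by blast
    have "inv\<^bsub>Isom\<^esub> (u ** A) *v e \<in> positive" if e: "e \<in> positive" for e
      using root_preimage[OF B positiveD(1)[OF e]] u(2)[OF e] mink_inv[OF BI, of e p]
      by (simp add: positive_def mink_commute)
    then have "inv\<^bsub>Isom\<^esub> (u ** A) \<in> \<Delta>" using B subgroup_closed(4)[OF subgroup] by (simp add: \<Delta>_def)
    then have "u ** A \<in> \<Delta>" using \<Delta>inv[of "inv\<^bsub>Isom\<^esub> (u ** A)"] Isom.inv_inv[OF BI] by simp
    then show "(\<lambda>h. h ** A) ` refl_group simple \<in> (\<lambda>g. (\<lambda>h. h ** g) ` refl_group simple) ` \<Delta>"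
      using right_coset_eq[OF subgroup_refl_group[of simple] u(1), of A] by blast
  qed
  then show ?thesis unfolding infinite_index_def using fin\<Delta> finite_subset by blast
qed

end

section \<open>Infinite index\<close>

text \<open>
  Write \<open>x = A *v p\<close> and \<open>y = A *v (refl s *v p)\<close>. If \<open>A\<close> is inverted by \<open>refl s\<close>, the two heights are,
  up to sign, the products of \<open>s\<close> with \<open>x\<close> and \<open>y\<close>, and the bound says that \<open>x\<close> and the mirror image of
  \<open>y\<close> satisfy the reversed Cauchy-Schwarz inequality.
\<close>

lemma reversed_heights:
  assumes p: "p \<in> hyperboloid" and s: "mink s s = 1" and A: "A \<in> carrier Isom"
    and rev: "refl s ** A ** refl s = inv\<^bsub>Isom\<^esub> A"
  shows "mink p (A *v s) * mink p (inv\<^bsub>Isom\<^esub> A *v s) \<le> (mink p s)\<^sup>2"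
proof -
  have S: "refl s \<in> carrier Isom" using s by (simp add: refl_in_Isom)
  define x where "x = A *v p"
  define y where "y = A *v (refl s *v p)"
  have xH: "x \<in> hyperboloid" using Isom_hyperboloid[OF A p] by (simp add: x_def)
  have yH: "refl s *v y \<in> hyperboloid"
    unfolding y_def using A S p by (intro Isom_hyperboloid)
  have xs: "mink x s = mink p (inv\<^bsub>Isom\<^esub> A *v s)"
    using mink_inv[OF A, of s p] by (simp add: x_def mink_commute)
  have ry: "refl s *v y = inv\<^bsub>Isom\<^esub> A *v p"
    unfolding y_def rev[symmetric] by (simp add: matrix_vector_mul_assoc matrix_mul_assoc)
  have "mink y s = - mink (refl s *v y) s"
    using s by (simp add: refl_unit mink_bilinear)
  then have ys: "mink y s = - mink p (A *v s)"
    using mink_inv[OF A, of p s] by (simp add: ry)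
  have "mink x y = mink p (refl s *v p)" using IsomD[OF A] by (simp add: x_def y_def)
  then have xy: "mink x y = -1 - 2 * (mink p s)\<^sup>2"
    using hyperboloidD(1)[OF p] s by (simp add: refl_unit mink_bilinear power2_eq_square)
  have "mink x (refl s *v y) = mink x y - 2 * mink y s * mink x s"
    using s by (simp add: refl_unit mink_bilinear)
  then have "mink x y - 2 * mink y s * mink x s \<le> -1" using mink_hyperboloid_le[OF xH yH] by simp
  then show ?thesis unfolding xy ys xs by simp
qed

context chamber
begin

text \<open>
  With finite index, some power of the translation \<open>T\<close> lies in the subgroup of \<open>I\<close>, whose elements
  keep \<open>s\<close> positive. Applied to the powers of that power and to their inverses, \<open>reversed_heights\<close>
  bounds the heights of all translates of \<open>s\<close>, so they repeat.
\<close>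

lemma infinite_index_insert_simple:
  assumes I: "I \<subseteq> simple" and s: "s \<in> simple" "s \<notin> I"
    and dense: "zariski_dense (refl_group (insert s I))"
  shows "infinite_index (refl_group I) (refl_group (insert s I))"
  unfolding infinite_index_def
proof
  let ?H = "refl_group I" and ?K = "refl_group (insert s I)"
  assume fin: "finite (rcosets\<^bsub>Isom\<lparr>carrier := ?K\<rparr>\<^esub> ?H)"
  have J: "insert s I \<subseteq> simple" using I s by blast
  have H: "subgroup ?H Isom" using subgroup_refl_group[OF I] .
  have K: "subgroup ?K Isom" using subgroup_refl_group[OF J] .
  have s1: "mink s s = 1" using simple_unit[OF s(1)] .
  have sK: "refl s \<in> ?K" by (intro generate.incl) blast
  have sI: "refl s \<in> carrier Isom" using s1 by (simp add: refl_in_Isom)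
  obtain A where A: "A \<in> ?K" "\<bar>mink s (A *v s)\<bar> > 1"
    using exists_ultraparallel_root[OF dense discrete_subgroup_subset[OF discrete K refl_group_in[OF J]], of s]
      s1 sK by (auto simp: roots_def)
  define f where "f = A *v s"
  have "f \<in> roots ?K" unfolding f_def using s1 sK by (intro roots_mult[OF K A(1)]) (simp add: roots_def)
  then have f: "mink f f = 1" "refl f \<in> ?K" by (auto dest: rootsD)
  have fI: "refl f \<in> carrier Isom" using f by (simp add: refl_in_Isom)
  define T where "T = refl s ** refl f"
  have TK: "T \<in> ?K" unfolding T_def by (rule subgroup_closed(1)[OF K sK f(2)])
  then have TI: "T \<in> carrier Isom" by (rule subgroup_closed(3)[OF K])
  define P where "P n = T [^]\<^bsub>Isom\<^esub> (n :: nat)" for n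
  have P_simps: "P 0 = mat 1" "P (Suc n) = P n ** T" "P (Suc n) = T ** P n" for n
    using Isom.nat_pow_Suc2[OF TI] by (simp_all add: P_def)
  have PI: "P n \<in> carrier Isom" for n using TI by (simp add: P_def)
  have PK: "P n \<in> ?K" for n
    by (induction n) (simp_all only: P_simps(1,2) generate_closed TK)
  have P_add: "P (m + n) = P m ** P n" for m n
    using Isom.nat_pow_mult[OF TI, of m n] by (simp add: P_def)
  have P_apply: "P n *v x = ((\<lambda>x. refl s *v (refl f *v x)) ^^ n) x" for n x
  proof (induction n)
    case (Suc n)
    then show ?case unfolding P_simps(3) T_def by (simp flip: matrix_vector_mul_assoc)
  qed (simp add: P_simps)
  have no_period: "P n *v s \<noteq> s" if n: "n > 0" for n
  proof -
    obtain m where "n = Suc m" using n gr0_implies_Suc by blast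
    then show ?thesis
      unfolding P_apply using ultraparallel_power_neq[OF s1 f(1), of m] A(2) by (simp add: f_def)
  qed
  have invT: "inv\<^bsub>Isom\<^esub> T = refl f ** refl s"
    using Isom.inv_mult_group[OF sI fI] s1 f by (simp add: T_def Isom_inv_refl)
  have rev: "refl s ** P n ** refl s = inv\<^bsub>Isom\<^esub> (P n)" for n
  proof (induction n)
    case 0
    have "inv\<^bsub>Isom\<^esub> (mat 1) = (mat 1 :: 'n mink_matrix)" using Isom.inv_one by simp
    then show ?case using s1 by (simp add: P_simps(1) refl_refl)
  next
    case (Suc n)
    have "refl s ** P (Suc n) ** refl s = refl s ** P n ** (refl s ** refl s) ** T ** refl s"
      using s1 by (simp add: P_simps(2) refl_refl matrix_mul_assoc)
    also have "\<dots> = (refl s ** P n ** refl s) ** ((refl s ** refl s) ** refl f ** refl s)"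
      by (simp add: T_def matrix_mul_assoc)
    also have "\<dots> = inv\<^bsub>Isom\<^esub> (P n) ** inv\<^bsub>Isom\<^esub> T" using Suc s1 by (simp add: invT refl_refl)
    also have "\<dots> = inv\<^bsub>Isom\<^esub> (P (Suc n))"
      using Isom.inv_mult_group[OF TI PI[of n]] by (simp add: P_simps(3))
    finally show ?case .
  qed
  \<comment> \<open>two powers of \<open>T\<close> lie in the same coset\<close>
  have "\<not> inj (\<lambda>n. (\<lambda>h. h ** P n) ` ?H)"
  proof
    assume "inj (\<lambda>n. (\<lambda>h. h ** P n) ` ?H)"
    then have "infinite (range (\<lambda>n. (\<lambda>h. h ** P n) ` ?H))" by (rule range_inj_infinite)
    moreover have "range (\<lambda>n. (\<lambda>h. h ** P n) ` ?H) \<subseteq> rcosets\<^bsub>Isom\<lparr>carrier := ?K\<rparr>\<^esub> ?H"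
      using PK by (auto simp: rcosets_eq)
    ultimately show False using fin finite_subset by blast
  qed
  then obtain i j where ij: "i < j" "(\<lambda>h. h ** P i) ` ?H = (\<lambda>h. h ** P j) ` ?H"
    by (metis (no_types, lifting) injI linorder_neq_iff)
  define k where "k = j - i"
  have k: "k > 0" "j = k + i" using ij by (auto simp: k_def)
  have "mat 1 ** P j \<in> (\<lambda>h. h ** P i) ` ?H" unfolding ij(2) using generate_closed(2) by blast
  then obtain h where h: "h \<in> ?H" "P k ** P i = h ** P i" by (auto simp: k(2) P_add)
  then have "P k = h"
    using Isom.right_cancel[of "P i" "P k" h] PI subgroup_closed(3)[OF H] by simp
  then have PkH: "P k \<in> ?H" using h(1) by simp
  have PknH: "P (k * n) \<in> ?H" for n
    by (induction n) (auto simp: P_simps P_add generate_closed PkH)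
  have sH: "refl s \<notin> ?H" using simple_refl_notin[OF I s] .
  have pos: "u *v s \<in> positive" if "u \<in> ?H" for u
    using positive_outside_preserved[OF I that simpleD(1)[OF s(1)] sH] .
  obtain c where c: "c > 0" "\<And>e. e \<in> positive \<Longrightarrow> mink p e \<ge> c" using height_bounded_below by blast
  have bound: "mink p (P (k * n) *v s) \<le> (mink p s)\<^sup>2 / c" for n
  proof -
    let ?x = "mink p (P (k * n) *v s)" and ?y = "mink p (inv\<^bsub>Isom\<^esub> (P (k * n)) *v s)"
    have xy: "?x \<ge> c" "?y \<ge> c"
      using c(2) pos PknH subgroup_closed(4)[OF H] by blast+
    have "?x * c \<le> ?x * ?y" using xy c by (intro mult_left_mono) auto
    also have "\<dots> \<le> (mink p s)\<^sup>2" by (rule reversed_heights[OF base s1 PI rev])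
    finally show ?thesis using c by (simp add: pos_le_divide_eq)
  qed
  then have "range (\<lambda>n. P (k * n) *v s) \<subseteq> {e \<in> positive. mink p e \<le> (mink p s)\<^sup>2 / c}"
    using pos PknH by blast
  then have "finite (range (\<lambda>n. P (k * n) *v s))" using finite_positive_le finite_subset by blast
  then have "\<not> inj (\<lambda>n. P (k * n) *v s)" using range_inj_infinite by blast
  then obtain m n where mn: "m < n" "P (k * m) *v s = P (k * n) *v s"
    by (metis (no_types, lifting) injI linorder_neq_iff)
  have "k * n = k * m + k * (n - m)" using mn(1) by (simp flip: add_mult_distrib2)
  then have "P (k * m) *v s = P (k * m) *v (P (k * (n - m)) *v s)"
    using mn(2) by (simp add: P_add matrix_vector_mul_assoc)
  then have "s = P (k * (n - m)) *v s" using Isom_inv_apply(1)[OF PI] by metis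
  then show False using no_period[of "k * (n - m)"] k(1) mn(1) by simp
qed

end

section \<open>Base points off all mirrors, and ascending chains\<close>

text \<open>
  There are countably many mirrors, and each is a null set.
\<close>

lemma exists_generic_point:
  fixes \<Gamma> :: "('n::finite) mink_matrix set"
  assumes "discrete_subgroup \<Gamma>"
  obtains p where "p \<in> hyperboloid" "\<And>e. e \<in> roots \<Gamma> \<Longrightarrow> mink p e \<noteq> 0"
proof -
  define U where "U = {x :: 'n minkowski. mink x x < 0} \<inter> {x. x $ None > 0}"
  have "roots \<Gamma> = (\<Union>n. {e \<in> roots \<Gamma>. norm e \<le> real n})"
    using real_arch_simple by auto
  moreover have "countable (\<Union>n. {e \<in> roots \<Gamma>. norm e \<le> real n})"
    by (rule countable_UN) (auto intro: countable_finite[OF finite_roots_norm[OF assms]])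
  ultimately have "countable (roots \<Gamma>)" by simp
  then have "countable ((\<lambda>e. {x. mink x e = 0}) ` roots \<Gamma>)" by simp
  moreover have "negligible {x. mink x e = 0}" if "e \<in> roots \<Gamma>" for e
  proof -
    have "time_flip e \<noteq> 0" using rootsD(1)[OF that] by auto
    then have "negligible {x. time_flip e \<bullet> x = 0}" by (intro negligible_hyperplane) simp
    then show ?thesis by (simp add: mink_inner[of e] mink_commute[of _ e])
  qed
  ultimately have "negligible (\<Union> ((\<lambda>e. {x. mink x e = 0}) ` roots \<Gamma>))"
    by (intro negligible_countable_Union) auto
  moreover have "open U" unfolding U_def
    by (intro open_Int open_Collect_less continuous_intros)
  moreover have "axis None 1 \<in> U" by (simp add: U_def mink_axis time_flip_def)
  ultimately have "\<not> U \<subseteq> (\<Union> ((\<lambda>e. {x. mink x e = 0}) ` roots \<Gamma>))"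
    using open_not_negligible negligible_subset by blast
  then obtain x where x: "x \<in> U" "\<And>e. e \<in> roots \<Gamma> \<Longrightarrow> mink x e \<noteq> 0" by blast
  define p where "p = (1 / sqrt (- mink x x)) *\<^sub>R x"
  have "p \<in> hyperboloid" using x(1)
    by (simp add: p_def U_def hyperboloid_def mink_scaleR)
  moreover have "mink p e \<noteq> 0" if "e \<in> roots \<Gamma>" for e
    using x(1) x(2)[OF that] by (simp add: p_def U_def mink_scaleR)
  ultimately show thesis using that by blast
qed

theorem theorem1p1:
  fixes \<Gamma> :: "('n::finite) mink_matrix set"
  assumes "CARD('n) \<ge> 2"
    and "discrete_subgroup \<Gamma>"
    and "finitely_generated \<Gamma>"
    and "zariski_dense \<Gamma>"
    and "\<exists>r\<in>\<Gamma>. is_reflection r"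
  shows "(\<exists>S. finite S \<and> (\<forall>r\<in>S. is_reflection r) \<and> generate Isom S \<subseteq> \<Gamma> \<and>
            discrete_subgroup (generate Isom S) \<and> zariski_dense (generate Isom S)) \<and>
         (infinite_index (max_reflection_subgroup \<Gamma>) \<Gamma> \<longrightarrow>
            (\<exists>W :: nat \<Rightarrow> 'n mink_matrix set.
               \<forall>n. W n \<subseteq> \<Gamma> \<and> reflection_group (W n) \<and> finitely_generated (W n) \<and>
                   zariski_dense (W n) \<and> W n \<subset> W (Suc n) \<and>
                   infinite_index (W n) (W (Suc n))))"
proof (intro conjI impI)
  note disc = assms(2) and dense = assms(4)
  have sub: "subgroup \<Gamma> Isom" using disc by (simp add: discrete_subgroup_def)
  obtain e where e: "e \<in> roots \<Gamma>" using assms(5) by (auto simp: roots_def is_reflection_iff)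
  obtain F where F: "finite F" "F \<subseteq> roots \<Gamma>" "zariski_dense (refl_group F)"
    using finite_roots_zariski_dense[OF dense disc e] .
  have F\<Gamma>: "refl_group F \<subseteq> \<Gamma>" using F(2) by (intro refl_group_subset[OF sub]) (auto simp: roots_def)
  show "\<exists>S. finite S \<and> (\<forall>r\<in>S. is_reflection r) \<and> generate Isom S \<subseteq> \<Gamma> \<and>
            discrete_subgroup (generate Isom S) \<and> zariski_dense (generate Isom S)"
  proof (intro exI[of _ "refl ` F"] conjI)
    show "discrete_subgroup (refl_group F)"
      by (rule discrete_subgroup_subset[OF disc refl_group_subgroup[OF F(2) sub] F\<Gamma>])
  qed (use F F\<Gamma> in \<open>auto simp: roots_def is_reflection_refl\<close>)
  assume inf: "infinite_index (max_reflection_subgroup \<Gamma>) \<Gamma>"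
  obtain p where p: "p \<in> hyperboloid" "\<And>e. e \<in> roots \<Gamma> \<Longrightarrow> mink p e \<noteq> 0"
    using exists_generic_point[OF disc] by blast
  interpret chamber \<Gamma> p by unfold_locales (use disc p in auto)
  have infs: "infinite simple"
    using finite_index_if_finite_simple[OF _ dense e] inf by (auto simp: max_reflection_subgroup_eq)
  have "\<exists>as. set as \<subseteq> simple \<and> refl f = word as" if "f \<in> F" for f
  proof -
    have "refl f \<in> refl_group simple" using refl_root_in_simple_group that F(2) by blast
    then obtain as where "set as \<subseteq> simple" "refl f = word as" by (rule simple_word[OF subset_refl])
    then show ?thesis by blast
  qed
  then obtain as where as: "\<And>f. f \<in> F \<Longrightarrow> set (as f) \<subseteq> simple" "\<And>f. f \<in> F \<Longrightarrow> refl f = word (as f)"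
    by metis
  define I0 where "I0 = (\<Union>f\<in>F. set (as f))"
  have I0: "finite I0" "I0 \<subseteq> simple" using F(1) as(1) by (auto simp: I0_def)
  have FI0: "refl ` F \<subseteq> refl_group I0"
  proof
    fix r assume "r \<in> refl ` F"
    then obtain f where "f \<in> F" "r = word (as f)" using as(2) by blast
    then show "r \<in> refl_group I0" using word_in_refl_group[of "as f" I0] by (auto simp: I0_def)
  qed
  have "infinite (simple - I0)" using infs I0(1) by simp
  then obtain a :: "nat \<Rightarrow> 'n minkowski" where a: "inj a" "range a \<subseteq> simple - I0"
    using infinite_countable_subset by blast
  define I where "I n = I0 \<union> a ` {..<n}" for n
  have I: "I n \<subseteq> simple" "finite (I n)" for n using I0 a(2) by (auto simp: I_def)
  have I_Suc: "I (Suc n) = insert (a n) (I n)" for n by (auto simp: I_def lessThan_Suc)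
  have new: "a n \<in> simple" "a n \<notin> I n" for n
    using a by (auto simp: I_def dest: injD)
  have unit: "f \<in> I n \<Longrightarrow> mink f f = 1" for f n using I(1) simple_unit by blast
  have sub_n: "subgroup (refl_group (I n)) Isom" for n using subgroup_refl_group[OF I(1)] .
  have "refl_group F \<subseteq> refl_group (I n)" for n
    using FI0 Isom.mono_generate[of "refl ` I0" "refl ` I n"]
    by (intro refl_group_subset[OF sub_n]) (auto simp: I_def)
  then have dense_n: "zariski_dense (refl_group (I n))" for n
    using F(3) zariski_hull_mono[of "refl_group F" "refl_group (I n)"] subgroup_closed(3)[OF sub_n]
    by (auto simp: zariski_dense_iff)
  show "\<exists>W :: nat \<Rightarrow> 'n mink_matrix set.
               \<forall>n. W n \<subseteq> \<Gamma> \<and> reflection_group (W n) \<and> finitely_generated (W n) \<and>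
                   zariski_dense (W n) \<and> W n \<subset> W (Suc n) \<and>
                   infinite_index (W n) (W (Suc n))"
  proof (intro exI[of _ "\<lambda>n. refl_group (I n)"] allI conjI)
    fix n
    show sub\<Gamma>: "refl_group (I n) \<subseteq> \<Gamma>" using refl_group_in[OF I(1)] .
    show "reflection_group (refl_group (I n))"
      unfolding reflection_group_def
      using discrete_subgroup_subset[OF disc sub_n sub\<Gamma>] unit
      by (intro conjI exI[of _ "refl ` I n"]) (auto simp: is_reflection_refl)
    show "finitely_generated (refl_group (I n))"
      unfolding finitely_generated_def using I(2) unit
      by (intro exI[of _ "refl ` I n"]) (auto simp: refl_in_Isom)
    show "zariski_dense (refl_group (I n))" by (rule dense_n)
    have "refl (a n) \<notin> refl_group (I n)" by (rule simple_refl_notin[OF I(1) new])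
    moreover have "refl (a n) \<in> refl_group (I (Suc n))" by (intro generate.incl) (simp add: I_Suc)
    moreover have "refl_group (I n) \<subseteq> refl_group (I (Suc n))"
      by (intro Isom.mono_generate) (auto simp: I_Suc)
    ultimately show "refl_group (I n) \<subset> refl_group (I (Suc n))" by blast
    show "infinite_index (refl_group (I n)) (refl_group (I (Suc n)))"
      using infinite_index_insert_simple[OF I(1) new] dense_n[of "Suc n"] by (simp add: I_Suc)
  qed
qed

end
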